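(* Let $\ell_1\le\dots\le\ell_\mu$, $a=\sum_i\ell_i$, and let $$\left\{\begin{bmatrix}I_d&E_{12}\\ 0&N\end{bmatrix},\begin{bmatrix}\Omega&0\\ 0&I_a\end{bmatrix}\right\}$$ be a sufficiently smooth pair of matrix functions in S-canonical form, i.e. $N\in SUT_{row}$ and $E_{12}=\begin{bmatrix}0&(E_{12})_2&\cdots&(E_{12})_\mu\end{bmatrix}$ with blocks $(E_{12})_j:\mathcal I\to\mathbb{R}^{d\times\ell_j}$. Then there exist $\tilde F_{22}\in BUT_{nonsingular}$ and a matrix function $\tilde F_{12}:\mathcal I\to\mathbb{R}^{d\times a}$ such that $$\left\{\begin{bmatrix}I_d&E_{12}\\ 0&N\end{bmatrix},\begin{bmatrix}\Omega&0\\ 0&I_a\end{bmatrix}\right\}\sim\left\{\begin{bmatrix}I_d&0\\ 0&N^{(E_r)}\end{bmatrix},\begin{bmatrix}\Omega&\tilde F_{12}\\ 0&\tilde F_{22}\end{bmatrix}\right\},$$ and the latter pair is in PreSCF. Moreover, this pair is equivalent to $$\left\{\begin{bmatrix}I_d&0\\ 0&N^{(E_r)}\end{bmatrix},\begin{bmatrix}\Omega&0\\ 0&I_a\end{bmatrix}\right\}$$ with the same $\Omega$.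
   Context: $\mathcal I\subseteq\mathbb{R}$ is an interval; all matrix functions are real and defined on $\mathcal I$; $'$ is differentiation in $t$. Equivalence: pairs of $m\times m$ matrix functions satisfy $\{E,F\}\sim\{\bar E,\bar F\}$ if there are pointwise nonsingular, sufficiently smooth $L,K:\mathcal I\to\mathbb{R}^{m\times m}$ with $\bar E=LEK$, $\bar F=LFK+LEK'$. Block structures: $\mu\ge 2$, positive integers $\ell_1\le\dots\le\ell_\mu$ with sum $a$; $a\times a$ matrix functions are partitioned into blocks of size $\ell_i\times\ell_j$. $BUT$: block upper triangular matrix functions (blocks $(i,j)$ with $i>j$ vanish). $BUT_{nonsingular}$: pointwise nonsingular elements of $BUT$. $SUT$: strictly block upper triangular ones (blocks $(i,j)$ with $i\ge j$ vanish). $SUT_{row}$: those $N\in SUT$ with $\operatorname{rank}N_{i,i+1}(t)=\ell_{i}$ for all $t\in\mathcal I$, $i=1,\dots,\mu-1$. $N^{(E_r)}$ is the constant matrix with blocks $N^{(E_r)}_{i,i+1}=\begin{bmatrix}I_{\ell_{i}}&0\end{bmatrix}$ and all other blocks zero. PreSCF: a pair $\left\{\begin{bmatrix} I_d&0\\ 0&N^{(E_r)}\end{bmatrix},\begin{bmatrix}F_{11}&F_{12}\\ F_{21}&F_{22}\end{bmatrix}\right\}$ is in PreSCF if $F_{22}\in BUT_{nonsingular}$ and $F_{21}F_{12}\in BUT$. *)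

theory Defs
  imports
    "HOL-Analysis.Analysis"
    "HOL-Library.Extended_Nat"
    "Jordan_Normal_Form.DL_Rank"
begin

section \<open>Matrix functions on an interval\<close>

text \<open>Sizes such as \<open>m = d + a\<close> depend on the block structure, and \<open>d = 0\<close> is possible, so
  matrices are taken from Jordan-Normal-Form. A matrix function is a total function of type
  \<open>real \<Rightarrow> real mat\<close> of which only the values on the interval \<open>I\<close> matter.\<close>

type_synonym matfun = "real \<Rightarrow> real mat"
type_synonym matpair = "matfun \<times> matfun"

definition matfun_on :: "real set \<Rightarrow> nat \<Rightarrow> nat \<Rightarrow> matfun set" where
  "matfun_on I nr nc = {M. \<forall>t\<in>I. M t \<in> carrier_mat nr nc}"

text \<open>Derivatives at endpoints belonging to \<open>I\<close> are one-sided.\<close>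

definition mat_deriv :: "real set \<Rightarrow> matfun \<Rightarrow> matfun" where
  "mat_deriv I M = (\<lambda>t. mat (dim_row (M t)) (dim_col (M t))
     (\<lambda>(p, q). vector_derivative (\<lambda>s. M s $$ (p, q)) (at t within I)))"

primrec cont_diff_on :: "nat \<Rightarrow> real set \<Rightarrow> (real \<Rightarrow> real) \<Rightarrow> bool" where
  "cont_diff_on 0 I f \<longleftrightarrow> continuous_on I f"
| "cont_diff_on (Suc n) I f \<longleftrightarrow>
     (\<exists>f'. (\<forall>t\<in>I. (f has_real_derivative f' t) (at t within I)) \<and> cont_diff_on n I f')"

text \<open>Class \<open>C\<^sup>k\<close> on \<open>I\<close>, where \<open>k = \<infinity>\<close> is allowed.\<close>

definition smooth_matfun :: "enat \<Rightarrow> real set \<Rightarrow> nat \<Rightarrow> nat \<Rightarrow> matfun set" where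
  "smooth_matfun k I nr nc =
     {M \<in> matfun_on I nr nc.
        \<forall>p<nr. \<forall>q<nc. \<forall>n. enat n \<le> k \<longrightarrow> cont_diff_on n I (\<lambda>t. M t $$ (p, q))}"

definition four_block_fun :: "matfun \<Rightarrow> matfun \<Rightarrow> matfun \<Rightarrow> matfun \<Rightarrow> matfun" where
  "four_block_fun A B C D = (\<lambda>t. four_block_mat (A t) (B t) (C t) (D t))"


section \<open>Equivalence of pairs\<close>

text \<open>The parameter \<open>k\<close> is the smoothness class of the two transformations. It is meant to be at
  least 1, since \<open>K\<close> is differentiated.\<close>

definition pair_equiv :: "enat \<Rightarrow> real set \<Rightarrow> nat \<Rightarrow> matpair \<Rightarrow> matpair \<Rightarrow> bool" where
  "pair_equiv k I m P P' \<longleftrightarrow>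
     (case P of (E, F) \<Rightarrow> case P' of (E', F') \<Rightarrow>
        E \<in> matfun_on I m m \<and> F \<in> matfun_on I m m \<and>
        E' \<in> matfun_on I m m \<and> F' \<in> matfun_on I m m \<and>
        (\<exists>L \<in> smooth_matfun k I m m. \<exists>K \<in> smooth_matfun k I m m. \<forall>t\<in>I.
           invertible_mat (L t) \<and> invertible_mat (K t) \<and>
           E' t = L t * E t * K t \<and>
           F' t = L t * F t * K t + L t * E t * mat_deriv I K t))"


section \<open>Block structures\<close>

text \<open>Blocks are numbered \<open>1, \<dots>, \<mu>\<close>, whereas rows and columns of matrices are numbered from 0:
  block row (or column) \<open>i\<close> consists of the indices
  \<open>block_start l i, \<dots>, block_start l i + l i - 1\<close>.\<close>

definition block_start :: "(nat \<Rightarrow> nat) \<Rightarrow> nat \<Rightarrow> nat" where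
  "block_start l i = (\<Sum>j = 1..<i. l j)"

definition total_size :: "nat \<Rightarrow> (nat \<Rightarrow> nat) \<Rightarrow> nat" where
  "total_size \<mu> l = (\<Sum>j = 1..\<mu>. l j)"

definition block :: "(nat \<Rightarrow> nat) \<Rightarrow> real mat \<Rightarrow> nat \<Rightarrow> nat \<Rightarrow> real mat" where
  "block l M i j = mat (l i) (l j) (\<lambda>(p, q). M $$ (block_start l i + p, block_start l j + q))"

definition col_block :: "(nat \<Rightarrow> nat) \<Rightarrow> real mat \<Rightarrow> nat \<Rightarrow> real mat" where
  "col_block l M j = mat (dim_row M) (l j) (\<lambda>(p, q). M $$ (p, block_start l j + q))"

definition BUT :: "real set \<Rightarrow> nat \<Rightarrow> (nat \<Rightarrow> nat) \<Rightarrow> matfun set" where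
  "BUT I \<mu> l = {M \<in> matfun_on I (total_size \<mu> l) (total_size \<mu> l).
     \<forall>t\<in>I. \<forall>i\<in>{1..\<mu>}. \<forall>j\<in>{1..\<mu>}. i > j \<longrightarrow> block l (M t) i j = 0\<^sub>m (l i) (l j)}"

definition BUT_nonsingular :: "real set \<Rightarrow> nat \<Rightarrow> (nat \<Rightarrow> nat) \<Rightarrow> matfun set" where
  "BUT_nonsingular I \<mu> l = {M \<in> BUT I \<mu> l. \<forall>t\<in>I. invertible_mat (M t)}"

definition SUT :: "real set \<Rightarrow> nat \<Rightarrow> (nat \<Rightarrow> nat) \<Rightarrow> matfun set" where
  "SUT I \<mu> l = {M \<in> matfun_on I (total_size \<mu> l) (total_size \<mu> l).
     \<forall>t\<in>I. \<forall>i\<in>{1..\<mu>}. \<forall>j\<in>{1..\<mu>}. i \<ge> j \<longrightarrow> block l (M t) i j = 0\<^sub>m (l i) (l j)}"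

text \<open>The second argument of \<open>vec_space.rank\<close> is the number of rows.\<close>

definition SUT_row :: "real set \<Rightarrow> nat \<Rightarrow> (nat \<Rightarrow> nat) \<Rightarrow> matfun set" where
  "SUT_row I \<mu> l = {N \<in> SUT I \<mu> l.
     \<forall>t\<in>I. \<forall>i\<in>{1..<\<mu>}. vec_space.rank (l i) (block l (N t) i (i + 1)) = l i}"

text \<open>The constant matrix whose blocks \<open>(i, i + 1)\<close> are \<open>[I 0]\<close> and whose other blocks vanish;
  see \<open>block_N_Er\<close> below. The blocks \<open>[I 0]\<close> make sense only for nondecreasing block sizes.\<close>

definition N_Er :: "nat \<Rightarrow> (nat \<Rightarrow> nat) \<Rightarrow> real mat" where
  "N_Er \<mu> l = mat (total_size \<mu> l) (total_size \<mu> l)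
     (\<lambda>(r, c). if \<exists>i\<in>{1..<\<mu>}. \<exists>p<l i. r = block_start l i + p \<and> c = block_start l (i + 1) + p
               then 1 else 0)"

lemma block_start_Suc: "i \<ge> 1 \<Longrightarrow> block_start l (Suc i) = block_start l i + l i"
  by (simp add: block_start_def)

lemma block_start_mono: "i \<le> j \<Longrightarrow> block_start l i \<le> block_start l j"
  unfolding block_start_def by (rule sum_mono2) auto

lemma block_index_less:
  assumes "i \<in> {1..\<mu>}" and "p < l i"
  shows "block_start l i + p < total_size \<mu> l"
proof -
  have "block_start l i + l i = block_start l (Suc i)"
    using assms by (simp add: block_start_Suc)
  also have "\<dots> \<le> block_start l (Suc \<mu>)"
    using assms by (intro block_start_mono) auto
  also have "\<dots> = total_size \<mu> l"
    by (simp add: block_start_def total_size_def atLeastLessThanSuc_atLeastAtMost)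
  finally show ?thesis
    using assms by linarith
qed

lemma block_index_unique:
  assumes "i \<ge> 1" "i' \<ge> 1" "p < l i" "p' < l i'"
    and "block_start l i + p = block_start l i' + p'"
  shows "i = i' \<and> p = p'"
proof -
  have False if "x \<ge> 1" "x < y" "q < l x" "block_start l x + q = block_start l y + q'"
    for x y q q'
    using that block_start_Suc[of x l] block_start_mono[of "Suc x" y l] by linarith
  then have "i = i'"
    using assms by (metis linorder_neqE_nat)
  then show ?thesis
    using assms by simp
qed

lemma block_N_Er:
  assumes "mono_on {1..\<mu>} l" and "i \<in> {1..\<mu>}" and "j \<in> {1..\<mu>}"
  shows "block l (N_Er \<mu> l) i j =
    (if j = i + 1 then mat (l i) (l j) (\<lambda>(p, q). if p = q then 1 else 0) else 0\<^sub>m (l i) (l j))"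
proof (rule eq_matI)
  fix p q
  let ?R = "if j = i + 1 then mat (l i) (l j) (\<lambda>(p, q). if p = q then 1 else 0)
            else 0\<^sub>m (l i) (l j) :: real mat"
  assume "p < dim_row ?R" "q < dim_col ?R"
  then have p: "p < l i" and q: "q < l j"
    by (auto split: if_splits)
  have mono: "l i' \<le> l (Suc i')" if "i' \<in> {1..<\<mu>}" for i'
    using assms(1) that by (auto simp: mono_on_def)
  have "(\<exists>i'\<in>{1..<\<mu>}. \<exists>p'<l i'. block_start l i + p = block_start l i' + p' \<and>
           block_start l j + q = block_start l (i' + 1) + p') \<longleftrightarrow> j = i + 1 \<and> p = q" (is "?A \<longleftrightarrow> ?B")
  proof
    assume ?A
    then obtain i' p' where *: "i' \<in> {1..<\<mu>}" "p' < l i'"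
      "block_start l i + p = block_start l i' + p'"
      "block_start l j + q = block_start l (i' + 1) + p'"
      by blast
    have "i = i' \<and> p = p'"
      using block_index_unique[of i i' p l p'] * assms p by auto
    moreover have "j = i' + 1 \<and> q = p'"
      using block_index_unique[of j "i' + 1" q l p'] * assms q mono[of i'] by auto
    ultimately show ?B by simp
  next
    assume ?B
    then show ?A using assms p by (intro bexI[of _ i] exI[of _ p]) auto
  qed
  then show "block l (N_Er \<mu> l) i j $$ (p, q) = ?R $$ (p, q)"
    using p q block_index_less[of i \<mu> p l] block_index_less[of j \<mu> q l] assms(2,3)
    by (auto simp: block_def N_Er_def)
qed (auto simp: block_def)


section \<open>S-canonical form and PreSCF\<close>

text \<open>\<open>S_canonical I d \<mu> l \<Omega> E12 N\<close> says that the pair \<open>{[I E12; 0 N], [\<Omega> 0; 0 I]}\<close> is in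
  S-canonical form.\<close>

definition S_canonical ::
  "real set \<Rightarrow> nat \<Rightarrow> nat \<Rightarrow> (nat \<Rightarrow> nat) \<Rightarrow> matfun \<Rightarrow> matfun \<Rightarrow> matfun \<Rightarrow> bool" where
  "S_canonical I d \<mu> l \<Omega> E12 N \<longleftrightarrow>
     \<Omega> \<in> matfun_on I d d \<and>
     E12 \<in> matfun_on I d (total_size \<mu> l) \<and>
     (\<forall>t\<in>I. col_block l (E12 t) 1 = 0\<^sub>m d (l 1)) \<and>
     N \<in> SUT_row I \<mu> l"

definition PreSCF :: "real set \<Rightarrow> nat \<Rightarrow> nat \<Rightarrow> (nat \<Rightarrow> nat) \<Rightarrow> matpair set" where
  "PreSCF I d \<mu> l = {(E, F). let a = total_size \<mu> l in
     \<exists>F11 F12 F21 F22.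
       F11 \<in> matfun_on I d d \<and> F12 \<in> matfun_on I d a \<and>
       F21 \<in> matfun_on I a d \<and> F22 \<in> BUT_nonsingular I \<mu> l \<and>
       (\<lambda>t. F21 t * F12 t) \<in> BUT I \<mu> l \<and>
       (\<forall>t\<in>I. E t = four_block_mat (1\<^sub>m d) (0\<^sub>m d a) (0\<^sub>m a d) (N_Er \<mu> l) \<and>
              F t = four_block_mat (F11 t) (F12 t) (F21 t) (F22 t))}"

end

theory Submission
  imports Defs
begin

text \<open>The canonical pair is already equivalent to \<open>{[I 0; 0 N\<^sup>E\<^sup>r], [\<Omega> 0; 0 I]}\<close>, so \<open>F12 = 0\<close> and \<open>F22 = I\<close>
  will do. Take \<open>L = [I A; 0 L\<^sub>2]\<close> and \<open>K = [I U; 0 K\<^sub>2]\<close>. The off-diagonal conditions say \<open>U = - B K\<^sub>2\<close>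
  and \<open>A = \<Omega> B + B'\<close> with \<open>B = E\<^sub>1\<^sub>2 + (\<Omega> B + B') N\<close>; since \<open>N\<close> is strictly upper triangular, this
  determines \<open>B\<close> column by column. The nilpotent part is transformed correctly iff
  \<open>L\<^sub>2 = (K\<^sub>2 + N K\<^sub>2')\<^sup>-\<^sup>1\<close> and \<open>N (K\<^sub>2 - K\<^sub>2' N\<^sup>E\<^sup>r) = K\<^sub>2 N\<^sup>E\<^sup>r\<close>. The latter is solved one block column at a
  time: the new column \<open>[X; Z]\<close> needs \<open>N\<^sub>i\<^sub>,\<^sub>i\<^sub>+\<^sub>1 Z = [K\<^sub>i\<^sub>i 0]\<close> with \<open>Z\<close> nonsingular, and then a system for \<open>X\<close>
  whose right-hand side vanishes in the last block, which is solvable because the blocks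
  \<open>N\<^sub>i\<^sub>,\<^sub>i\<^sub>+\<^sub>1\<close> have full row rank.

  The only analytic point is the existence of a globally smooth nonsingular \<open>W\<close> with
  \<open>N\<^sub>i\<^sub>,\<^sub>i\<^sub>+\<^sub>1 W = [I 0]\<close>. By induction on the rows it reduces to one nowhere vanishing row \<open>g(t)\<close> of length
  \<open>q\<close>. For \<open>q \<ge> 3\<close> the cone over the curve \<open>g\<close> has measure zero, hence some constant vector \<open>v\<close>
  is never parallel to \<open>g(t)\<close>, and a transvection depending rationally on \<open>g\<close> maps \<open>g\<close> to \<open>v\<close>. For
  \<open>q = 2\<close> a rotation does it.\<close>

section \<open>Smooth functions on an interval\<close>

text \<open>Derivatives within \<open>I\<close> see only the values on \<open>I\<close>, so total
  functions may be exchanged as soon as they agree there.\<close>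

lemma cont_diff_on_cong:
  "(\<And>t. t \<in> I \<Longrightarrow> f t = g t) \<Longrightarrow> cont_diff_on n I f \<longleftrightarrow> cont_diff_on n I g"
proof (cases n)
  case (Suc m)
  assume eq: "\<And>t. t \<in> I \<Longrightarrow> f t = g t"
  have "(f has_real_derivative D) (at t within I) \<longleftrightarrow> (g has_real_derivative D) (at t within I)"
    if "t \<in> I" for t D
    unfolding has_field_derivative_def
    by (rule iffI; erule has_derivative_transform[OF that, rotated]; simp add: eq)
  then show ?thesis by (simp add: Suc)
qed auto

lemma cont_diff_on_imp_continuous_on: "cont_diff_on n I f \<Longrightarrow> continuous_on I f"
  by (cases n) (auto intro: DERIV_continuous_on)

lemma cont_diff_on_lower: "cont_diff_on (Suc n) I f \<Longrightarrow> cont_diff_on n I f"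
proof (induction n arbitrary: f)
  case 0
  then show ?case using cont_diff_on_imp_continuous_on by fastforce
next
  case (Suc n)
  then show ?case by (metis cont_diff_on.simps(2))
qed

lemma cont_diff_on_const: "cont_diff_on n I (\<lambda>_. c)"
  by (induction n arbitrary: c) (auto intro!: exI[of _ "\<lambda>_. 0"])

lemma cont_diff_on_SucI:
  "cont_diff_on n I f' \<Longrightarrow> (\<And>t. t \<in> I \<Longrightarrow> (f has_real_derivative f' t) (at t within I))
    \<Longrightarrow> cont_diff_on (Suc n) I f"
  by auto

lemma cont_diff_on_add:
  "cont_diff_on n I f \<Longrightarrow> cont_diff_on n I g \<Longrightarrow> cont_diff_on n I (\<lambda>t. f t + g t)"
proof (induction n arbitrary: f g)
  case (Suc n)
  then obtain f' g' where
    "\<forall>t\<in>I. (f has_real_derivative f' t) (at t within I)" "cont_diff_on n I f'"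
    "\<forall>t\<in>I. (g has_real_derivative g' t) (at t within I)" "cont_diff_on n I g'"
    by auto
  with Suc.IH show ?case
    by (auto intro!: exI[of _ "\<lambda>t. f' t + g' t"] derivative_eq_intros)
qed (auto intro: continuous_intros)

lemma cont_diff_on_mult:
  "cont_diff_on n I f \<Longrightarrow> cont_diff_on n I g \<Longrightarrow> cont_diff_on n I (\<lambda>t. f t * g t)"
proof (induction n arbitrary: f g)
  case (Suc n)
  then obtain f' g' where
    "\<forall>t\<in>I. (f has_real_derivative f' t) (at t within I)" "cont_diff_on n I f'"
    "\<forall>t\<in>I. (g has_real_derivative g' t) (at t within I)" "cont_diff_on n I g'"
    by auto
  note d = this
  have "cont_diff_on n I (\<lambda>t. f' t * g t + f t * g' t)"
    by (rule cont_diff_on_add[OF Suc.IH[OF d(2) Suc.prems(2)[THEN cont_diff_on_lower]]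
          Suc.IH[OF Suc.prems(1)[THEN cont_diff_on_lower] d(4)]])
  moreover have "((\<lambda>t. f t * g t) has_real_derivative f' t * g t + f t * g' t) (at t within I)"
    if "t \<in> I" for t
    using DERIV_mult[of f "f' t" t I g "g' t"] d(1,3) that by (simp add: mult.commute)
  ultimately show ?case
    by (rule cont_diff_on_SucI)
qed (auto intro: continuous_intros)

lemma cont_diff_on_inverse:
  assumes "\<forall>t\<in>I. f t \<noteq> 0"
  shows "cont_diff_on n I f \<Longrightarrow> cont_diff_on n I (\<lambda>t. inverse (f t))"
proof (induction n)
  case 0
  then show ?case using assms by (auto intro: continuous_intros)
next
  case (Suc n)
  then obtain f' where f': "\<forall>t\<in>I. (f has_real_derivative f' t) (at t within I)" "cont_diff_on n I f'"
    by auto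
  have "cont_diff_on n I (\<lambda>t. inverse (f t))"
    using Suc cont_diff_on_lower by blast
  then have "cont_diff_on n I (\<lambda>t. (- 1) * (inverse (f t) * (f' t * inverse (f t))))"
    using f' by (intro cont_diff_on_mult cont_diff_on_const)
  moreover have "((\<lambda>t. inverse (f t)) has_real_derivative (- 1) * (inverse (f t) * (f' t * inverse (f t))))
      (at t within I)" if "t \<in> I" for t
    using assms f'(1) that by (auto intro!: derivative_eq_intros)
  ultimately show ?case
    by (rule cont_diff_on_SucI)
qed

text \<open>The scalar counterpart of \<open>smooth_matfun\<close>. All analytic constructions are
  carried out on families of scalar entries and are packed into matrices only at the end.\<close>

definition smooth_on :: "enat \<Rightarrow> real set \<Rightarrow> (real \<Rightarrow> real) \<Rightarrow> bool" where
  "smooth_on k I f \<longleftrightarrow> (\<forall>n. enat n \<le> k \<longrightarrow> cont_diff_on n I f)"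

lemma smooth_on_mono: "smooth_on k I f \<Longrightarrow> k' \<le> k \<Longrightarrow> smooth_on k' I f"
  by (simp add: smooth_on_def)

lemma smooth_on_cong: "(\<And>t. t \<in> I \<Longrightarrow> f t = g t) \<Longrightarrow> smooth_on k I f \<longleftrightarrow> smooth_on k I g"
  by (simp add: smooth_on_def cont_diff_on_cong[of I f g])

lemma smooth_on_const [simp]: "smooth_on k I (\<lambda>_. c)"
  by (simp add: smooth_on_def cont_diff_on_const)

lemma smooth_on_add: "smooth_on k I f \<Longrightarrow> smooth_on k I g \<Longrightarrow> smooth_on k I (\<lambda>t. f t + g t)"
  by (simp add: smooth_on_def cont_diff_on_add)

lemma smooth_on_mult: "smooth_on k I f \<Longrightarrow> smooth_on k I g \<Longrightarrow> smooth_on k I (\<lambda>t. f t * g t)"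
  by (simp add: smooth_on_def cont_diff_on_mult)

lemma smooth_on_inverse:
  "smooth_on k I f \<Longrightarrow> \<forall>t\<in>I. f t \<noteq> 0 \<Longrightarrow> smooth_on k I (\<lambda>t. inverse (f t))"
  by (simp add: smooth_on_def cont_diff_on_inverse)

lemma smooth_on_minus: "smooth_on k I f \<Longrightarrow> smooth_on k I (\<lambda>t. - f t)"
  using smooth_on_mult[of k I "\<lambda>_. - 1" f] by simp

lemma smooth_on_diff: "smooth_on k I f \<Longrightarrow> smooth_on k I g \<Longrightarrow> smooth_on k I (\<lambda>t. f t - g t)"
  using smooth_on_add[OF _ smooth_on_minus, of k I f g] by simp

lemma smooth_on_divide:
  "smooth_on k I f \<Longrightarrow> smooth_on k I g \<Longrightarrow> \<forall>t\<in>I. g t \<noteq> 0 \<Longrightarrow> smooth_on k I (\<lambda>t. f t / g t)"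
  by (simp add: divide_inverse smooth_on_mult smooth_on_inverse)

lemma smooth_on_sum:
  "(\<And>x. x \<in> X \<Longrightarrow> smooth_on k I (f x)) \<Longrightarrow> smooth_on k I (\<lambda>t. \<Sum>x\<in>X. f x t)"
  by (induction X rule: infinite_finite_induct) (auto intro: smooth_on_add)

lemma smooth_on_prod:
  "(\<And>x. x \<in> X \<Longrightarrow> smooth_on k I (f x)) \<Longrightarrow> smooth_on k I (\<lambda>t. \<Prod>x\<in>X. f x t)"
  by (induction X rule: infinite_finite_induct) (auto intro: smooth_on_mult)

lemma smooth_matfun_iff:
  "M \<in> smooth_matfun k I nr nc \<longleftrightarrow>
    (\<forall>t\<in>I. M t \<in> carrier_mat nr nc) \<and> (\<forall>i<nr. \<forall>j<nc. smooth_on k I (\<lambda>t. M t $$ (i, j)))"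
  by (simp add: smooth_matfun_def matfun_on_def smooth_on_def)

section \<open>Derivatives on a nondegenerate interval\<close>

locale nontrivial_interval =
  fixes I :: "real set"
  assumes interval: "is_interval I" and interior: "interior I \<noteq> {}"
begin

definition D :: "(real \<Rightarrow> real) \<Rightarrow> real \<Rightarrow> real" where
  "D f = (\<lambda>t. vector_derivative f (at t within I))"

abbreviation sm :: "enat \<Rightarrow> (real \<Rightarrow> real) \<Rightarrow> bool" where "sm k \<equiv> smooth_on k I"

text \<open>A connected set with more than one point has no isolated points. Hence derivatives
  within \<open>I\<close> are unique, and the value chosen by \<open>vector_derivative\<close> is
  the derivative whenever one exists.\<close>

lemma not_bot: "t \<in> I \<Longrightarrow> at t within I \<noteq> bot"
proof -
  assume "t \<in> I"
  have "I \<noteq> {x}" for x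
    using interior by auto
  then have "t islimpt I"
    using \<open>t \<in> I\<close> interval connected_imp_perfect is_interval_connected by blast
  then show ?thesis
    using trivial_limit_within by blast
qed

lemma D_eq: "(f has_real_derivative d) (at t within I) \<Longrightarrow> t \<in> I \<Longrightarrow> D f t = d"
  unfolding D_def
  by (simp add: has_real_derivative_iff_has_vector_derivative not_bot vector_derivative_within)

lemma D_const [simp]: "t \<in> I \<Longrightarrow> D (\<lambda>_. c) t = 0"
  by (rule D_eq) auto

lemma D_derivative:
  assumes "sm k f" "k \<ge> 1" "t \<in> I"
  shows "(f has_real_derivative D f t) (at t within I)"
proof -
  have "cont_diff_on (Suc 0) I f"
    using assms by (simp add: smooth_on_def one_enat_def del: cont_diff_on.simps)
  then obtain f' where "\<forall>t\<in>I. (f has_real_derivative f' t) (at t within I)"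
    by auto
  with D_eq assms(3) show ?thesis by metis
qed

text \<open>By uniqueness, the derivative supplied by \<open>cont_diff_on\<close> agrees with
  \<open>D f\<close> on \<open>I\<close>. One order is lost; an infinite \<open>k\<close> is
  included because \<open>k + 1\<close> is then infinite too.\<close>

lemma smooth_D: 
  assumes "sm (k + 1) f"
  shows "sm k (D f)"
  unfolding smooth_on_def
proof safe
  fix n assume "enat n \<le> k"
  then have "enat (Suc n) \<le> k + 1"
    using add_mono[OF _ order_refl[of "1::enat"]] by (fastforce simp: one_enat_def)
  then have "cont_diff_on (Suc n) I f"
    using assms unfolding smooth_on_def by blast
  then obtain f' where f': "\<forall>t\<in>I. (f has_real_derivative f' t) (at t within I)" "cont_diff_on n I f'"
    by auto
  then show "cont_diff_on n I (D f)"
    using D_eq cont_diff_on_cong[of I "D f" f' n] by auto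
qed

lemma D_mult:
  assumes "sm k f" "sm k g" "k \<ge> 1" "t \<in> I"
  shows "D (\<lambda>t. f t * g t) t = D f t * g t + f t * D g t"
  using D_eq[OF DERIV_mult[OF D_derivative[OF assms(1,3,4)] D_derivative[OF assms(2,3,4)]] assms(4)]
  by (simp add: mult.commute)

lemma D_minus:
  assumes "sm k f" "k \<ge> 1" "t \<in> I"
  shows "D (\<lambda>t. - f t) t = - D f t"
  by (rule D_eq[OF DERIV_minus[OF D_derivative[OF assms]] assms(3)])

lemma D_sum:
  assumes "\<And>x. x \<in> X \<Longrightarrow> sm k (f x)" "k \<ge> 1" "t \<in> I"
  shows "D (\<lambda>t. \<Sum>x\<in>X. f x t) t = (\<Sum>x\<in>X. D (f x) t)"
  by (rule D_eq[OF DERIV_sum[OF D_derivative[OF assms(1-3)]] assms(3)])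

end

section \<open>Nonsingular families of matrices\<close>

lemma sum_lessThan_add:
  fixes f :: "nat \<Rightarrow> real"
  shows "(\<Sum>i<a + b. f i) = (\<Sum>i<a. f i) + (\<Sum>i<b. f (a + i))"
  by (induction b) (auto simp: add.assoc)

definition \<delta> :: "nat \<Rightarrow> nat \<Rightarrow> real" where
  "\<delta> i j = (if i = j then 1 else 0)"

lemma sum_delta_left [simp]: "(\<Sum>p<m. \<delta> i p * f p) = (if i < m then f i else 0)"
  by (simp add: \<delta>_def if_distrib[of "\<lambda>x. x * _"] cong: if_cong)

lemma sum_delta_right [simp]: "(\<Sum>p<m. f p * \<delta> p j) = (if j < m then f j else 0)"
  by (simp add: \<delta>_def if_distrib[of "\<lambda>x. _ * x"] cong: if_cong)

text \<open>Trivial kernel of the leading \<open>m\<close> by \<open>m\<close> corner of an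
  unbounded array. In this form block arguments are elementary, and appending a block needs no
  change of matrix dimensions.\<close>

definition nonsing :: "nat \<Rightarrow> (nat \<Rightarrow> nat \<Rightarrow> real) \<Rightarrow> bool" where
  "nonsing m A \<longleftrightarrow> (\<forall>v. (\<forall>i<m. (\<Sum>j<m. A i j * v j) = 0) \<longrightarrow> (\<forall>j<m. v j = 0))"

lemma nonsingI:
  assumes "\<And>v j. (\<And>i. i < m \<Longrightarrow> (\<Sum>j<m. A i j * v j) = 0) \<Longrightarrow> j < m \<Longrightarrow> v j = 0"
  shows "nonsing m A"
  unfolding nonsing_def
proof (intro allI impI)
  fix v j assume "\<forall>i<m. (\<Sum>j<m. A i j * v j) = 0" "j < m"
  then show "v j = 0" using assms[of v j] by simp
qed

lemma nonsingD:
  assumes "nonsing m A" "\<And>i. i < m \<Longrightarrow> (\<Sum>j<m. A i j * v j) = 0" "j < m"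
  shows "v j = 0"
  by (rule assms(1)[unfolded nonsing_def, rule_format, OF assms(2,3)])

text \<open>A square matrix over a field is singular iff it kills a nonzero vector. This connects
  kernel arguments with transposition and with the adjugate formula for inverses.\<close>

lemma nonsing_iff_det: "nonsing m A \<longleftrightarrow> det (mat m m (\<lambda>(i, j). A i j)) \<noteq> 0"
proof -
  let ?A = "mat m m (\<lambda>(i, j). A i j)"
  have *: "?A *\<^sub>v v = 0\<^sub>v m \<longleftrightarrow> (\<forall>i<m. (\<Sum>j<m. A i j * v $ j) = 0)" if "v \<in> carrier_vec m" for v
    using that by (auto simp: vec_eq_iff scalar_prod_def lessThan_atLeast0)
  have z: "v = 0\<^sub>v m \<longleftrightarrow> (\<forall>j<m. v $ j = 0)" if "v \<in> carrier_vec m" for v :: "real Matrix.vec"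
    using that by (auto simp: vec_eq_iff)
  have "det ?A = 0 \<longleftrightarrow> (\<exists>v. v \<in> carrier_vec m \<and> v \<noteq> 0\<^sub>v m \<and> ?A *\<^sub>v v = 0\<^sub>v m)"
    by (rule det_0_iff_vec_prod_zero_field) simp
  also have "\<dots> \<longleftrightarrow> \<not> nonsing m A"
  proof
    assume "\<exists>v. v \<in> carrier_vec m \<and> v \<noteq> 0\<^sub>v m \<and> ?A *\<^sub>v v = 0\<^sub>v m"
    then obtain v where "v \<in> carrier_vec m" "v \<noteq> 0\<^sub>v m" "?A *\<^sub>v v = 0\<^sub>v m"
      by blast
    then show "\<not> nonsing m A"
      using * z nonsingD[of m A "\<lambda>j. v $ j"] by blast
  next
    assume "\<not> nonsing m A"
    then obtain v where v: "\<forall>i<m. (\<Sum>j<m. A i j * v j) = 0" "\<not> (\<forall>j<m. v j = 0)"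
      unfolding nonsing_def by blast
    have "Matrix.vec m v \<in> carrier_vec m" "Matrix.vec m v \<noteq> 0\<^sub>v m"
      using v(2) z[of "Matrix.vec m v"] by auto
    moreover have "?A *\<^sub>v Matrix.vec m v = 0\<^sub>v m"
      using v(1) by (subst *) auto
    ultimately show "\<exists>v. v \<in> carrier_vec m \<and> v \<noteq> 0\<^sub>v m \<and> ?A *\<^sub>v v = 0\<^sub>v m"
      by blast
  qed
  finally show ?thesis by blast
qed

lemma nonsing_transpose: "nonsing m (\<lambda>i j. A j i) \<longleftrightarrow> nonsing m A"
proof -
  have "mat m m (\<lambda>(i, j). A j i) = transpose_mat (mat m m (\<lambda>(i, j). A i j))"
    by (rule eq_matI) auto
  then show ?thesis
    by (simp add: nonsing_iff_det det_transpose[of _ m])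
qed

lemma nonsing_mult:
  assumes "nonsing m A" "nonsing m B"
  shows "nonsing m (\<lambda>i j. \<Sum>p<m. A i p * B p j)"
  unfolding nonsing_def
proof (intro allI impI)
  fix v j assume v: "\<forall>i<m. (\<Sum>j<m. (\<Sum>p<m. A i p * B p j) * v j) = 0" and j: "j < m"
  have "(\<Sum>p<m. A i p * (\<Sum>j<m. B p j * v j)) = (\<Sum>j<m. (\<Sum>p<m. A i p * B p j) * v j)" for i
    by (simp add: sum_distrib_left sum_distrib_right mult.assoc) (rule sum.swap)
  with v have *: "(\<Sum>p<m. A i p * (\<Sum>j<m. B p j * v j)) = 0" if "i < m" for i
    using that by simp
  have "(\<Sum>j<m. B p j * v j) = 0" if "p < m" for p
    by (rule nonsingD[OF assms(1) * that])
  then show "v j = 0"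
    by (rule nonsingD[OF assms(2) _ j])
qed

text \<open>In a kernel vector the last \<open>b\<close> components are killed by \<open>Z\<close>,
  and then the first \<open>a\<close> components by \<open>A\<close>; the upper right block is
  arbitrary.\<close>

lemma nonsing_block_upper:
  assumes "nonsing a A" "nonsing b Z"
    and A: "\<And>i j. i < a \<Longrightarrow> j < a \<Longrightarrow> K i j = A i j"
    and 0: "\<And>i j. i < b \<Longrightarrow> j < a \<Longrightarrow> K (a + i) j = 0"
    and Z: "\<And>i j. i < b \<Longrightarrow> j < b \<Longrightarrow> K (a + i) (a + j) = Z i j"
  shows "nonsing (a + b) K"
  unfolding nonsing_def
proof (intro allI impI)
  fix v j assume v: "\<forall>i<a + b. (\<Sum>j<a + b. K i j * v j) = 0" and j: "j < a + b"
  have "(\<Sum>j<b. Z i j * v (a + j)) = 0" if "i < b" for i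
    using v[rule_format, of "a + i"] that by (simp add: sum_lessThan_add 0 Z)
  then have b: "v (a + j) = 0" if "j < b" for j
    by (rule nonsingD[OF assms(2) _ that, of "\<lambda>j. v (a + j)"])
  then have "(\<Sum>j<a. K i j * v j) = 0" if "i < a" for i
    using v[rule_format, of i] that by (simp add: sum_lessThan_add)
  then have "(\<Sum>j<a. A i j * v j) = 0" if "i < a" for i
    using that A by simp
  then have "v j = 0" if "j < a" for j
    by (rule nonsingD[OF assms(1) _ that])
  then show "v j = 0"
    using b[of "j - a"] j by (cases "j < a") auto
qed

lemma nonsing_block_lower:
  assumes "nonsing a A" "nonsing b Z"
    and "\<And>i j. i < a \<Longrightarrow> j < a \<Longrightarrow> K i j = A i j"
    and "\<And>i j. i < a \<Longrightarrow> j < b \<Longrightarrow> K i (a + j) = 0"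
    and "\<And>i j. i < b \<Longrightarrow> j < b \<Longrightarrow> K (a + i) (a + j) = Z i j"
  shows "nonsing (a + b) K"
proof -
  have "nonsing (a + b) (\<lambda>i j. K j i)"
    by (rule nonsing_block_upper[OF iffD2[OF nonsing_transpose assms(1)] iffD2[OF nonsing_transpose assms(2)]])
      (simp_all add: assms(3-5))
  then show ?thesis
    by (rule iffD1[OF nonsing_transpose])
qed

lemma nonsing_delta: "nonsing m \<delta>"
  by (simp add: nonsing_def)

text \<open>The matrix is the identity plus the rank-one product of the column \<open>x\<close> and
  the row \<open>v - g\<close>. Since \<open>g\<close> pairs with \<open>x\<close> to 1, the row
  \<open>g\<close> goes to \<open>g + (v - g) = v\<close>; since \<open>v - g\<close> pairs with
  \<open>x\<close> to 0, the matrix is nonsingular.\<close>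

lemma transvection:
  fixes g v x :: "nat \<Rightarrow> real"
  assumes "(\<Sum>p<q. g p * x p) = 1" "(\<Sum>p<q. v p * x p) = 1"
  shows "nonsing q (\<lambda>i j. \<delta> i j + x i * (v j - g j))"
    and "j < q \<Longrightarrow> (\<Sum>p<q. g p * (\<delta> p j + x p * (v j - g j))) = v j"
proof -
  show "nonsing q (\<lambda>i j. \<delta> i j + x i * (v j - g j))"
    unfolding nonsing_def
  proof (intro allI impI)
    fix w j assume w: "\<forall>i<q. (\<Sum>j<q. (\<delta> i j + x i * (v j - g j)) * w j) = 0" and j: "j < q"
    define s where "s = (\<Sum>j<q. (v j - g j) * w j)"
    have w_eq: "w i + x i * s = 0" if "i < q" for i
      using w[rule_format, OF that] that
      by (simp add: s_def sum_distrib_left distrib_right sum.distrib mult.assoc)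
    \<comment> \<open>Pairing the kernel equation with \<open>v - g\<close> removes the
      \<open>x\<close> term and leaves \<open>s\<close> alone.\<close>
    have "0 = (\<Sum>i<q. (v i - g i) * (w i + x i * s))"
      by (simp add: w_eq)
    also have "\<dots> = (\<Sum>i<q. (v i - g i) * w i) + (\<Sum>i<q. (v i - g i) * (x i * s))"
      by (simp add: distrib_left sum.distrib)
    also have "(\<Sum>i<q. (v i - g i) * (x i * s)) = ((\<Sum>p<q. v p * x p) - (\<Sum>p<q. g p * x p)) * s"
      by (simp add: left_diff_distrib sum_subtractf sum_distrib_right mult.assoc)
    also have "(\<Sum>i<q. (v i - g i) * w i) = s"
      by (simp add: s_def)
    finally have "s = 0"
      by (simp add: assms)
    then show "w j = 0"
      using w_eq[OF j] by simp
  qed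
  show "(\<Sum>p<q. g p * (\<delta> p j + x p * (v j - g j))) = v j" if "j < q"
  proof -
    have "(\<Sum>p<q. g p * (\<delta> p j + x p * (v j - g j))) =
        (\<Sum>p<q. g p * \<delta> p j) + (\<Sum>p<q. g p * x p) * (v j - g j)"
      by (simp only: distrib_left sum.distrib sum_distrib_right mult.assoc)
    then show ?thesis
      using that assms by simp
  qed
qed

section \<open>A constant direction avoiding the cone over a curve\<close>

context nontrivial_interval
begin

text \<open>The cone is the image of a subset of the plane under a differentiable map into
  three-space, hence negligible. The plane \<open>H\<close> is removed as well, so that the first
  coordinate of the chosen vector can be scaled to 1.\<close>

lemma exists_vector_avoiding_cone:
  assumes "\<And>t. t \<in> I \<Longrightarrow> (f has_real_derivative f' t) (at t within I)"
    "\<And>t. t \<in> I \<Longrightarrow> (g has_real_derivative g' t) (at t within I)"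
    "\<And>t. t \<in> I \<Longrightarrow> (h has_real_derivative h' t) (at t within I)"
  obtains y z where "\<And>r t. t \<in> I \<Longrightarrow> (1, y, z) \<noteq> (r * f t, r * g t, r * h t)"
proof -
  let ?F = "\<lambda>(r, t). (r * f t, r * g t, r * h t)"
  have comp: "((\<lambda>x. \<phi> (snd x)) has_derivative (\<lambda>x. \<phi>' (snd p) * snd x)) (at p within UNIV \<times> I)"
    if "\<And>t. t \<in> I \<Longrightarrow> (\<phi> has_real_derivative \<phi>' t) (at t within I)" "p \<in> UNIV \<times> I"
    for \<phi> \<phi>' :: "real \<Rightarrow> real" and p :: "real \<times> real"
  proof (rule has_derivative_in_compose2[of I \<phi> "\<lambda>t s. \<phi>' t * s" snd])
    show "(\<phi> has_derivative (*) (\<phi>' t)) (at t within I)" if "t \<in> I" for t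
      using \<open>\<And>t. t \<in> I \<Longrightarrow> (\<phi> has_real_derivative \<phi>' t) (at t within I)\<close>[OF that]
      by (simp add: has_field_derivative_def)
    show "(snd has_derivative snd) (at p within UNIV \<times> I)"
      by (rule has_derivative_snd[OF has_derivative_ident])
  qed (use that in auto)
  have "?F differentiable_on UNIV \<times> I"
    unfolding differentiable_on_def
  proof
    fix p :: "real \<times> real" assume p: "p \<in> UNIV \<times> I"
    note d = comp[of f f', OF assms(1) p] comp[of g g', OF assms(2) p] comp[of h h', OF assms(3) p]
    have "((\<lambda>p. (fst p * f (snd p), fst p * g (snd p), fst p * h (snd p))) has_derivative
        (\<lambda>x. (fst p * (f' (snd p) * snd x) + fst x * f (snd p),
          fst p * (g' (snd p) * snd x) + fst x * g (snd p),
          fst p * (h' (snd p) * snd x) + fst x * h (snd p)))) (at p within UNIV \<times> I)"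
      by (intro has_derivative_Pair has_derivative_mult has_derivative_fst[OF has_derivative_ident] d)
    then show "?F differentiable at p within UNIV \<times> I"
      unfolding case_prod_beta by (rule differentiableI)
  qed
  then have F: "negligible (?F ` (UNIV \<times> I))"
    by (rule negligible_differentiable_image_lowdim[rotated]) simp
  define H where "H = {x :: real \<times> real \<times> real. inner (1, 0, 0) x = 0}"
  have "negligible H"
    unfolding H_def by (rule negligible_hyperplane) (simp add: zero_prod_def)
  define S where "S = ?F ` (UNIV \<times> I) \<union> H"
  have "negligible S"
    unfolding S_def using F \<open>negligible H\<close> by (rule negligible_Un)
  then have "S \<noteq> UNIV"
    by (rule contrapos_pn) (simp add: non_negligible_UNIV)
  then obtain w where w: "w \<notin> S"
    by blast
  obtain x y z where xyz: "w = (x, y, z)"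
    by (cases w)
  have v: "(x, y, z) \<notin> ?F ` (UNIV \<times> I)" and "(x, y, z) \<notin> H"
    using w unfolding S_def xyz by blast+
  then have x: "x \<noteq> 0"
    by (simp add: H_def)
  \<comment> \<open>The cone is stable under scaling: the factor \<open>x\<close> is absorbed into
    \<open>r\<close>.\<close>
  have "(1, y / x, z / x) \<noteq> (r * f t, r * g t, r * h t)" if "t \<in> I" for r t
  proof
    assume "(1, y / x, z / x) = (r * f t, r * g t, r * h t)"
    then have "(x, y, z) = ?F (x * r, t)"
      using x by (auto simp: field_simps)
    with v that show False by blast
  qed
  then show thesis by (rule that)
qed

end

section \<open>Smooth normal form of a matrix function of full row rank\<close>

lemma sum_mult_assoc:
  fixes u :: "nat \<Rightarrow> real"
  shows "(\<Sum>p<m. u p * (\<Sum>r<n. A p r * B r)) = (\<Sum>r<n. (\<Sum>p<m. u p * A p r) * B r)"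
proof -
  have "(\<Sum>p<m. u p * (\<Sum>r<n. A p r * B r)) = (\<Sum>p<m. \<Sum>r<n. u p * A p r * B r)"
    by (simp add: sum_distrib_left mult.assoc)
  also have "\<dots> = (\<Sum>r<n. \<Sum>p<m. u p * A p r * B r)"
    by (rule sum.swap)
  finally show ?thesis
    by (simp add: sum_distrib_right)
qed

context nontrivial_interval
begin

text \<open>Two transvections are composed: \<open>T\<close> carries \<open>g\<close> to a constant
  vector \<open>v\<close>, and the constant matrix \<open>T'\<close> carries \<open>v\<close> to the
  unit row. Avoiding the cone over the first three components makes \<open>g\<close> and
  \<open>v\<close> linearly independent at every \<open>t\<close>.\<close>

lemma row_to_unit_ge3:
  assumes "3 \<le> q" and k: "1 \<le> k" and g: "\<And>j. j < q \<Longrightarrow> sm k (g j)"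
    and nz: "\<And>t. t \<in> I \<Longrightarrow> \<exists>j<q. g j t \<noteq> 0"
  obtains T where "\<And>i j. i < q \<Longrightarrow> j < q \<Longrightarrow> sm k (T i j)"
    "\<And>t. t \<in> I \<Longrightarrow> nonsing q (\<lambda>i j. T i j t)"
    "\<And>t j. t \<in> I \<Longrightarrow> j < q \<Longrightarrow> (\<Sum>p<q. g p t * T p j t) = \<delta> 0 j"
proof -
  obtain y z where yz: "\<And>r t. t \<in> I \<Longrightarrow> (1, y, z) \<noteq> (r * g 0 t, r * g 1 t, r * g 2 t)"
    using exists_vector_avoiding_cone[OF D_derivative[OF g k] D_derivative[OF g k] D_derivative[OF g k],
        of 0 1 2] assms(1) by auto
  define v where "v j = (if j = 0 then 1 else if j = 1 then y else if j = 2 then z else 0)" for j :: nat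
  define a where "a t = (\<Sum>p<q. g p t * g p t)" for t
  define b where "b t = (\<Sum>p<q. g p t * v p)" for t
  define c where "c = (\<Sum>p<q. v p * v p)"
  define \<Delta> where "\<Delta> t = a t * c - b t * b t" for t
  \<comment> \<open>the element \<open>x\<close> of the span of \<open>g\<close> and \<open>v\<close> with \<open>g \<bullet> x = v \<bullet> x = 1\<close>; \<open>\<Delta>\<close> is the Gram determinant\<close>
  define x where "x p t = ((c - b t) * g p t + (a t - b t) * v p) / \<Delta> t" for p t
  define T where "T i j t = \<delta> i j + x i t * (v j - g j t)" for i j t
  \<comment> \<open>A transvection along the first unit vector, which pairs to 1 both with
    \<open>v\<close>, as \<open>v 0 = 1\<close>, and with the target row.\<close>
  define T' where "T' i j = \<delta> i j + \<delta> i 0 * (\<delta> 0 j - v j)" for i j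
  have "v 0 * v 0 \<le> c"
    unfolding c_def by (rule member_le_sum) (use assms(1) in auto)
  then have c: "c > 0"
    by (simp add: v_def)
  \<comment> \<open>This is the equality case of Cauchy-Schwarz: \<open>c * \<Delta> t\<close> is
    the squared norm of \<open>c g - b v\<close>. If it vanished, \<open>v\<close> would be a
    multiple of \<open>g\<close>, and its first three components \<open>(1, y, z)\<close> would lie
    on the cone.\<close>
  have \<Delta>: "\<Delta> t \<noteq> 0" if t: "t \<in> I" for t
  proof
    assume 0: "\<Delta> t = 0"
    have "(\<Sum>p<q. (c * g p t - b t * v p)\<^sup>2) =
        (\<Sum>p<q. c * c * (g p t * g p t) - 2 * c * b t * (g p t * v p) + b t * b t * (v p * v p))"
      by (rule sum.cong) (auto simp: power2_eq_square algebra_simps)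
    also have "\<dots> = c * c * a t - 2 * c * b t * b t + b t * b t * c"
      by (simp only: sum.distrib sum_subtractf sum_distrib_left[symmetric] a_def[symmetric]
          b_def[symmetric] c_def[symmetric])
    also have "\<dots> = c * \<Delta> t"
      by (simp add: \<Delta>_def algebra_simps)
    finally have "(\<Sum>p<q. (c * g p t - b t * v p)\<^sup>2) = 0"
      using 0 by simp
    then have "\<forall>p\<in>{..<q}. (c * g p t - b t * v p)\<^sup>2 = 0"
      by (subst (asm) sum_nonneg_eq_0_iff) simp_all
    then have gv: "c * g p t = b t * v p" if "p < q" for p
      using that by simp
    obtain j where j: "j < q" "g j t \<noteq> 0"
      using nz[OF t] by blast
    have b0: "b t \<noteq> 0"
      using gv[OF j(1)] j(2) c by auto
    define e where "e = c / b t"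
    have v: "v p = e * g p t" if "p < q" for p
      using gv[OF that] b0 by (simp add: e_def field_simps)
    have "(1, y, z) = (e * g 0 t, e * g 1 t, e * g 2 t)"
      using v[of 0, symmetric] v[of 1, symmetric] v[of 2, symmetric] assms(1) by (simp add: v_def)
    then show False
      using yz[OF t] by blast
  qed
  have x_eq: "(\<Sum>p<q. w p * x p t) =
      ((c - b t) * (\<Sum>p<q. w p * g p t) + (a t - b t) * (\<Sum>p<q. w p * v p)) / \<Delta> t" for w t
  proof -
    have "(\<Sum>p<q. w p * x p t) =
        (\<Sum>p<q. ((c - b t) * (w p * g p t) + (a t - b t) * (w p * v p)) / \<Delta> t)"
      by (rule sum.cong) (auto simp: x_def algebra_simps)
    also have "\<dots> = ((c - b t) * (\<Sum>p<q. w p * g p t) + (a t - b t) * (\<Sum>p<q. w p * v p)) / \<Delta> t"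
      by (simp only: sum_divide_distrib[symmetric] sum.distrib sum_distrib_left[symmetric])
    finally show ?thesis .
  qed
  have gx: "(\<Sum>p<q. g p t * x p t) = 1" if "t \<in> I" for t
  proof -
    have "(\<Sum>p<q. g p t * x p t) = ((c - b t) * a t + (a t - b t) * b t) / \<Delta> t"
      unfolding x_eq a_def[symmetric] b_def[symmetric] ..
    also have "(c - b t) * a t + (a t - b t) * b t = \<Delta> t"
      by (simp add: \<Delta>_def algebra_simps)
    finally show ?thesis
      using \<Delta>[OF that] by simp
  qed
  have vx: "(\<Sum>p<q. v p * x p t) = 1" if "t \<in> I" for t
  proof -
    have "(\<Sum>p<q. v p * g p t) = b t"
      by (simp add: b_def mult.commute)
    then have "(\<Sum>p<q. v p * x p t) = ((c - b t) * b t + (a t - b t) * c) / \<Delta> t"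
      unfolding x_eq c_def[symmetric] by simp
    also have "(c - b t) * b t + (a t - b t) * c = \<Delta> t"
      by (simp add: \<Delta>_def algebra_simps)
    finally show ?thesis
      using \<Delta>[OF that] by simp
  qed
  have v0: "(\<Sum>p<q. v p * \<delta> p 0) = 1" "(\<Sum>p<q. \<delta> 0 p * \<delta> p 0) = 1"
    using assms(1) by (simp_all add: v_def) (simp add: \<delta>_def)
  show thesis
  proof (rule that[of "\<lambda>i j t. \<Sum>p<q. T i p t * T' p j"])
    have sa: "sm k a" unfolding a_def by (intro smooth_on_sum smooth_on_mult g) auto
    have sb: "sm k b" unfolding b_def by (intro smooth_on_sum smooth_on_mult g smooth_on_const) auto
    have "sm k \<Delta>" unfolding \<Delta>_def by (intro smooth_on_diff smooth_on_mult sa sb smooth_on_const)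
    then have sx: "sm k (x i)" if "i < q" for i
      unfolding x_def using \<Delta> that
      by (intro smooth_on_divide smooth_on_add smooth_on_mult smooth_on_diff smooth_on_const sa sb g) auto
    show "sm k (\<lambda>t. \<Sum>p<q. T i p t * T' p j)" if "i < q" "j < q" for i j
      unfolding T_def using that
      by (intro smooth_on_sum smooth_on_mult smooth_on_add smooth_on_diff smooth_on_const sx g) auto
  next
    fix t assume t: "t \<in> I"
    have "nonsing q (\<lambda>i j. T i j t)"
      unfolding T_def by (rule transvection(1)[OF gx[OF t] vx[OF t]])
    moreover have "nonsing q T'"
      unfolding T'_def by (rule transvection(1)[OF v0])
    ultimately show "nonsing q (\<lambda>i j. \<Sum>p<q. T i p t * T' p j)"
      by (rule nonsing_mult)
    fix j assume j: "j < q"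
    have "(\<Sum>p<q. g p t * (\<Sum>r<q. T p r t * T' r j)) = (\<Sum>r<q. (\<Sum>p<q. g p t * T p r t) * T' r j)"
      by (rule sum_mult_assoc)
    also have "\<dots> = (\<Sum>r<q. v r * T' r j)"
      unfolding T_def by (rule sum.cong) (auto simp: transvection(2)[OF gx[OF t] vx[OF t]])
    also have "\<dots> = \<delta> 0 j"
      unfolding T'_def by (rule transvection(2)[OF v0 j])
    finally show "(\<Sum>p<q. g p t * (\<Sum>r<q. T p r t * T' r j)) = \<delta> 0 j" .
  qed
qed

text \<open>Length two is treated separately because the cone over a planar curve may fill the whole
  plane. Length one is a division, and for length zero the matrix is empty.\<close>

lemma row_to_unit:
  assumes k: "1 \<le> k" and g: "\<And>j. j < q \<Longrightarrow> sm k (g j)"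
    and nz: "\<And>t. t \<in> I \<Longrightarrow> \<exists>j<q. g j t \<noteq> 0"
  obtains T where "\<And>i j. i < q \<Longrightarrow> j < q \<Longrightarrow> sm k (T i j)"
    "\<And>t. t \<in> I \<Longrightarrow> nonsing q (\<lambda>i j. T i j t)"
    "\<And>t j. t \<in> I \<Longrightarrow> j < q \<Longrightarrow> (\<Sum>p<q. g p t * T p j t) = \<delta> 0 j"
proof -
  consider "q = 0" | "q = 1" | "q = 2" | "3 \<le> q"
    by linarith
  then show thesis
  proof cases
    case 1
    show thesis
      by (rule that[of "\<lambda>_ _ _. 0"]) (use 1 in \<open>simp_all add: nonsing_def\<close>)
  next
    case 2
    have g0: "g 0 t \<noteq> 0" if "t \<in> I" for t
      using nz[OF that] 2 by auto
    show thesis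
    proof (rule that[of "\<lambda>_ _ t. inverse (g 0 t)"])
      show "sm k (\<lambda>t. inverse (g 0 t))"
        using g0 g[of 0] 2 by (intro smooth_on_inverse) auto
    qed (use g0 2 in \<open>auto simp: nonsing_def \<delta>_def\<close>)
  next
    case 3
    define n where "n t = g 0 t * g 0 t + g 1 t * g 1 t" for t
    have n0: "n t \<noteq> 0" if "t \<in> I" for t
    proof -
      obtain j where "j < q" "g j t \<noteq> 0"
        using nz \<open>t \<in> I\<close> by blast
      then have "g 0 t \<noteq> 0 \<or> g 1 t \<noteq> 0"
        using 3 by (cases "j = 0") (auto simp: less_2_cases_iff)
      then show ?thesis
        unfolding n_def by (simp add: sum_squares_eq_zero_iff)
    qed
    have sn: "sm k n"
      unfolding n_def using 3 by (intro smooth_on_add smooth_on_mult g) auto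
    \<comment> \<open>A rotation up to a scalar; division by the squared norm \<open>n\<close> turns
      the product of \<open>g\<close> and \<open>T\<close> into \<open>[1 0]\<close>.\<close>
    define T where "T i j t = (if i = j then g 0 t else if i = 0 then - g 1 t else g 1 t) / n t"
      for i j :: nat and t
    have two: "(\<Sum>p<q. h p) = h 0 + h 1" for h :: "nat \<Rightarrow> real"
      using 3 by (simp add: numeral_2_eq_2)
    show thesis
    proof (rule that[of T])
      show "sm k (T i j)" for i j
      proof -
        have "sm k (\<lambda>t. if i = j then g 0 t else if i = 0 then - g 1 t else g 1 t)"
          using smooth_on_minus[of k I "g 1"] g[of 0] g[of 1] 3
          by (cases "i = j"; cases "i = 0") simp_all
        then show ?thesis
          unfolding T_def using n0 sn by (intro smooth_on_divide) auto
      qed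
    next
      fix t assume t: "t \<in> I"
      show "nonsing q (\<lambda>i j. T i j t)"
      proof (rule nonsingI)
        fix v :: "nat \<Rightarrow> real" and j
        assume v: "\<And>i. i < q \<Longrightarrow> (\<Sum>j<q. T i j t * v j) = 0" and j: "j < q"
        have e0: "g 0 t * v 0 - g 1 t * v 1 = 0"
          using v[of 0, unfolded two] n0[OF t] 3 by (simp add: T_def field_simps)
        have e1: "g 1 t * v 0 + g 0 t * v 1 = 0"
          using v[of 1, unfolded two] n0[OF t] 3 by (simp add: T_def field_simps)
        \<comment> \<open>The system is multiplied by the transposed matrix, which isolates each
          unknown with the factor \<open>n t\<close>.\<close>
        have "n t * v 0 = g 0 t * (g 0 t * v 0 - g 1 t * v 1) + g 1 t * (g 1 t * v 0 + g 0 t * v 1)"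
          by (simp add: n_def algebra_simps)
        moreover have "n t * v 1 = g 0 t * (g 1 t * v 0 + g 0 t * v 1) - g 1 t * (g 0 t * v 0 - g 1 t * v 1)"
          by (simp add: n_def algebra_simps)
        ultimately have "v 0 = 0" "v 1 = 0"
          unfolding e0 e1 using n0[OF t] by simp_all
        then show "v j = 0"
          using j 3 by (cases "j = 0") (auto simp: less_2_cases_iff)
      qed
      fix j assume j: "j < q"
      then consider "j = 0" | "j = 1"
        using 3 by linarith
      then show "(\<Sum>p<q. g p t * T p j t) = \<delta> 0 j"
      proof cases
        case 1
        have "(\<Sum>p<q. g p t * T p 0 t) = (g 0 t * g 0 t + g 1 t * g 1 t) / n t"
          by (simp add: two T_def add_divide_distrib)
        also have "\<dots> = 1"
          using n0[OF t] unfolding n_def by (rule divide_self)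
        finally show ?thesis
          using 1 by (simp add: \<delta>_def)
      qed (simp add: two T_def \<delta>_def)
    qed
  next
    case 4
    show thesis
      by (rule row_to_unit_ge3[OF 4 k g nz that])
  qed
qed

lemma ex_point: "\<exists>t. t \<in> I"
  using interior interior_subset by fastforce

text \<open>Induction on the number of rows. Once the first \<open>r\<close> rows are
  \<open>[I 0]\<close>, row independence forces the next row to have a nowhere vanishing tail beyond
  column \<open>r\<close>. This tail is taken to a unit row, and the entries before it are cleared,
  without disturbing the earlier rows.\<close>

lemma full_row_rank_normal_form:
  assumes k: "1 \<le> k" and n: "\<And>i j. i < r \<Longrightarrow> j < m \<Longrightarrow> sm k (n i j)"
    and indep: "\<And>t c i. t \<in> I \<Longrightarrow> (\<And>j. j < m \<Longrightarrow> (\<Sum>i<r. c i * n i j t) = 0) \<Longrightarrow> i < r \<Longrightarrow> c i = 0"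
  obtains W where "\<And>i j. i < m \<Longrightarrow> j < m \<Longrightarrow> sm k (W i j)"
    "\<And>t. t \<in> I \<Longrightarrow> nonsing m (\<lambda>i j. W i j t)"
    "\<And>t i j. t \<in> I \<Longrightarrow> i < r \<Longrightarrow> j < m \<Longrightarrow> (\<Sum>p<m. n i p t * W p j t) = \<delta> i j"
proof -
  have "\<exists>W. (\<forall>i<m. \<forall>j<m. sm k (W i j)) \<and> (\<forall>t\<in>I. nonsing m (\<lambda>i j. W i j t)) \<and>
      (\<forall>t\<in>I. \<forall>i<r. \<forall>j<m. (\<Sum>p<m. n i p t * W p j t) = \<delta> i j)"
    using n indep
  proof (induction r)
    case 0
    show ?case
      by (rule exI[of _ "\<lambda>i j _. \<delta> i j"]) (simp add: nonsing_delta)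
  next
    case (Suc r)
    have "\<exists>W. (\<forall>i<m. \<forall>j<m. sm k (W i j)) \<and> (\<forall>t\<in>I. nonsing m (\<lambda>i j. W i j t)) \<and>
      (\<forall>t\<in>I. \<forall>i<r. \<forall>j<m. (\<Sum>p<m. n i p t * W p j t) = \<delta> i j)"
    proof (rule Suc.IH)
      show "sm k (n i j)" if "i < r" "j < m" for i j
        using that by (intro Suc.prems(1)) auto
      fix t c i assume t: "t \<in> I" and c: "\<And>j. j < m \<Longrightarrow> (\<Sum>i<r. c i * n i j t) = 0" and i: "i < r"
      define c' where "c' i = (if i < r then c i else 0)" for i
      have "c' i = 0"
      proof (rule Suc.prems(2)[OF t])
        show "(\<Sum>i<Suc r. c' i * n i j t) = 0" if "j < m" for j
          using c[OF that] by (simp add: c'_def)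
      qed (use i in simp)
      then show "c i = 0"
        using i by (simp add: c'_def)
    qed
    then obtain W where IH: "\<forall>i<m. \<forall>j<m. sm k (W i j)" "\<forall>t\<in>I. nonsing m (\<lambda>i j. W i j t)"
      "\<forall>t\<in>I. \<forall>i<r. \<forall>j<m. (\<Sum>p<m. n i p t * W p j t) = \<delta> i j"
      by (elim exE conjE)
    note W = IH(1,2)[rule_format] and nW = IH(3)[rule_format]
    \<comment> \<open>The row \<open>r\<close> after the transformation \<open>W\<close> obtained
      for the earlier rows.\<close>
    define c where "c j t = (\<Sum>p<m. n r p t * W p j t)" for j t
    have sc: "sm k (c j)" if "j < m" for j
      unfolding c_def using that by (intro smooth_on_sum smooth_on_mult Suc.prems W) auto
    \<comment> \<open>With a vanishing tail, row \<open>r\<close> minus the combination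
      \<open>w\<close> subtracts would be annihilated by the transpose of \<open>W\<close>, hence be
      zero; this is a linear relation among the rows in which row \<open>r\<close> has coefficient
      1.\<close>
    have nz: "\<exists>j<m. r \<le> j \<and> c j t \<noteq> 0" if t: "t \<in> I" for t
    proof (rule ccontr)
      assume "\<not> ?thesis"
      then have 0: "c j t = 0" if "j < m" "r \<le> j" for j
        using that by blast
      define w where "w p = n r p t - (\<Sum>i<r. c i t * n i p t)" for p
      have w0: "(\<Sum>p<m. W p j t * w p) = 0" if j: "j < m" for j
      proof -
        have "(\<Sum>p<m. W p j t * w p) = c j t - (\<Sum>p<m. W p j t * (\<Sum>i<r. n i p t * c i t))"
          by (simp add: w_def c_def right_diff_distrib sum_subtractf mult.commute)
        also have "(\<Sum>p<m. W p j t * (\<Sum>i<r. n i p t * c i t)) = (\<Sum>i<r. (\<Sum>p<m. W p j t * n i p t) * c i t)"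
          by (rule sum_mult_assoc)
        also have "\<dots> = (\<Sum>i<r. c i t * \<delta> i j)"
          by (rule sum.cong) (auto simp: nW[OF t _ j, symmetric] mult.commute)
        also have "\<dots> = c j t"
          using 0[OF j] by simp
        finally show ?thesis by simp
      qed
      have tr: "nonsing m (\<lambda>j p. W p j t)"
        by (rule iffD2[OF nonsing_transpose W(2)[OF t]])
      have w: "w p = 0" if "p < m" for p
        by (rule nonsingD[OF tr w0 that])
      define c' where "c' i = (if i < r then - c i t else 1)" for i
      have "c' r = 0"
      proof (rule Suc.prems(2)[OF t])
        show "(\<Sum>i<Suc r. c' i * n i p t) = 0" if "p < m" for p
          using w[OF that] by (simp add: c'_def w_def sum_negf)
      qed simp
      then show False
        by (simp add: c'_def)
    qed
    \<comment> \<open>One point of \<open>I\<close> turns the pointwise nonvanishing into the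
      inequality \<open>r < m\<close>, which is independent of \<open>t\<close>.\<close>
    obtain t0 where "t0 \<in> I"
      using ex_point by blast
    with nz have "r < m"
      by (meson le_less_trans)
    define q where "q = m - r"
    have m: "m = r + q"
      using \<open>r < m\<close> by (simp add: q_def)
    have nz': "\<exists>j<q. c (r + j) t \<noteq> 0" if "t \<in> I" for t
    proof -
      obtain j where "j < m" "r \<le> j" "c j t \<noteq> 0"
        using nz[OF \<open>t \<in> I\<close>] by blast
      then show ?thesis
        by (intro exI[of _ "j - r"]) (simp add: m)
    qed
    obtain T where T: "\<And>i j. i < q \<Longrightarrow> j < q \<Longrightarrow> sm k (T i j)"
      "\<And>t. t \<in> I \<Longrightarrow> nonsing q (\<lambda>i j. T i j t)"
      and cT: "\<And>t j. t \<in> I \<Longrightarrow> j < q \<Longrightarrow> (\<Sum>p<q. c (r + p) t * T p j t) = \<delta> 0 j"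
    proof (rule row_to_unit[of k q "\<lambda>j. c (r + j)"])
      show "sm k (c (r + j))" if "j < q" for j
        using that by (intro sc) (simp add: m)
    qed (use k nz' in auto)
    \<comment> \<open>In block form \<open>E = [I 0; Y T]\<close>, where \<open>Y\<close> is minus
      the product of column 0 of \<open>T\<close> with the head of \<open>c\<close>. The tail of
      \<open>c\<close> times that column is 1, so the head of \<open>c\<close> is cancelled; the
      upper blocks \<open>[I 0]\<close> preserve the rows already treated.\<close>
    define E where "E p j t = (if j < r then (if p < r then \<delta> p j else - T (p - r) 0 t * c j t)
        else (if p < r then 0 else T (p - r) (j - r) t))" for p j t
    have sE: "sm k (E p j)" if "p < m" "j < m" for p j
    proof -
      have "E p j = (if j < r then (if p < r then (\<lambda>t. \<delta> p j) else (\<lambda>t. - T (p - r) 0 t * c j t))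
        else (if p < r then (\<lambda>t. 0) else (\<lambda>t. T (p - r) (j - r) t)))"
        by (rule ext) (simp add: E_def)
      moreover have "sm k (\<lambda>t. - T (p - r) 0 t * c j t)" if "\<not> p < r"
        using that \<open>p < m\<close> \<open>j < m\<close> by (intro smooth_on_mult smooth_on_minus T(1) sc) (auto simp: m)
      moreover have "sm k (T (p - r) (j - r))" if "\<not> p < r" "\<not> j < r"
        using that \<open>p < m\<close> \<open>j < m\<close> by (intro T(1)) (auto simp: m)
      ultimately show ?thesis by simp
    qed
    have nE: "nonsing m (\<lambda>i j. E i j t)" if "t \<in> I" for t
      unfolding m by (rule nonsing_block_lower[OF nonsing_delta T(2)[OF that]]) (simp_all add: E_def)
    define W' where "W' p j t = (\<Sum>s<m. W p s t * E s j t)" for p j t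
    have nW': "(\<Sum>p<m. n i p t * W' p j t) = (\<Sum>s<m. (\<Sum>p<m. n i p t * W p s t) * E s j t)" for i j t
      unfolding W'_def by (rule sum_mult_assoc)
    show ?case
    proof (intro exI[of _ W'] conjI ballI allI impI)
      show "sm k (W' i j)" if "i < m" "j < m" for i j
        unfolding W'_def using that by (intro smooth_on_sum smooth_on_mult W sE) auto
    next
      fix t assume t: "t \<in> I"
      show "nonsing m (\<lambda>i j. W' i j t)"
        unfolding W'_def by (rule nonsing_mult[OF W(2)[OF t] nE[OF t]])
      fix i j assume i: "i < Suc r" and j: "j < m"
      show "(\<Sum>p<m. n i p t * W' p j t) = \<delta> i j"
      proof (cases "i < r")
        case True
        have "(\<Sum>s<m. (\<Sum>p<m. n i p t * W p s t) * E s j t) = (\<Sum>s<m. \<delta> i s * E s j t)"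
          by (rule sum.cong) (simp_all add: nW[OF t True])
        also have "\<dots> = E i j t"
          using True \<open>r < m\<close> by simp
        also have "\<dots> = \<delta> i j"
          using True by (simp add: E_def) (simp add: \<delta>_def)
        finally show ?thesis
          unfolding nW' .
      next
        case False
        then have [simp]: "i = r"
          using i by simp
        have "(\<Sum>p<m. n i p t * W' p j t) = (\<Sum>s<r + q. c s t * E s j t)"
          unfolding nW' by (simp add: c_def m)
        also have "\<dots> = (\<Sum>s<r. c s t * E s j t) + (\<Sum>s<q. c (r + s) t * E (r + s) j t)"
          by (rule sum_lessThan_add)
        also have "\<dots> = \<delta> r j"
        proof (cases "j < r")
          case True
          have "(\<Sum>s<q. c (r + s) t * E (r + s) j t) = (\<Sum>s<q. c (r + s) t * T s 0 t) * (- c j t)"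
            unfolding sum_distrib_right using True by (intro sum.cong) (simp_all add: E_def)
          also have "\<dots> = - c j t"
            using cT[OF t, of 0] \<open>r < m\<close> by (simp add: m \<delta>_def)
          finally show ?thesis
            using True by (simp add: E_def) (simp add: \<delta>_def)
        next
          case False
          then show ?thesis
            using cT[OF t, of "j - r"] j by (simp add: E_def m) (auto simp: \<delta>_def)
        qed
        finally show ?thesis by simp
      qed
    qed
  qed
  then obtain W where "\<forall>i<m. \<forall>j<m. sm k (W i j)" "\<forall>t\<in>I. nonsing m (\<lambda>i j. W i j t)"
      "\<forall>t\<in>I. \<forall>i<r. \<forall>j<m. (\<Sum>p<m. n i p t * W p j t) = \<delta> i j"
    by (elim exE conjE)
  then show thesis
    by (intro that[of W]) simp_all
qed

end

section \<open>Transformation of the nilpotent part\<close>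

lemma total_size_Suc: "total_size (Suc i) l = total_size i l + l (Suc i)"
  by (simp add: total_size_def)

lemma total_size_0 [simp]: "total_size 0 l = 0"
  by (simp add: total_size_def)

lemma total_size_mono: "i \<le> j \<Longrightarrow> total_size i l \<le> total_size j l"
  unfolding total_size_def by (rule sum_mono2) auto

lemma block_start_eq_total_size: "block_start l (Suc i) = total_size i l"
  by (simp add: block_start_def total_size_def atLeastLessThanSuc_atLeastAtMost)

text \<open>The entries of \<open>N_Er\<close> without a bound on the block number. The same
  function therefore serves every truncation to initial blocks in the inductions.\<close>

definition shift_entry :: "(nat \<Rightarrow> nat) \<Rightarrow> nat \<Rightarrow> nat \<Rightarrow> real" where
  "shift_entry l p c =
    (if \<exists>i q. q < l (Suc i) \<and> p = total_size i l + q \<and> c = total_size (Suc i) l + q then 1 else 0)"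

lemma N_Er_entry:
  assumes "r < total_size \<mu> l" "c < total_size \<mu> l"
  shows "N_Er \<mu> l $$ (r, c) = shift_entry l r c"
proof -
  have "(\<exists>i\<in>{1..<\<mu>}. \<exists>p<l i. r = block_start l i + p \<and> c = block_start l (i + 1) + p) \<longleftrightarrow>
      (\<exists>i q. q < l (Suc i) \<and> r = total_size i l + q \<and> c = total_size (Suc i) l + q)" (is "?A \<longleftrightarrow> ?B")
  proof
    assume ?A
    then obtain i p where "i \<in> {1..<\<mu>}" "p < l i" "r = block_start l i + p" "c = block_start l (i + 1) + p"
      by blast
    then show ?B
      by (intro exI[of _ "i - 1"] exI[of _ p]) (simp flip: block_start_eq_total_size)
  next
    assume ?B
    then obtain i q where *: "q < l (Suc i)" "r = total_size i l + q" "c = total_size (Suc i) l + q"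
      by blast
    have "Suc i < \<mu>"
    proof (rule ccontr)
      assume "\<not> Suc i < \<mu>"
      then have "total_size \<mu> l \<le> total_size (Suc i) l"
        by (intro total_size_mono) simp
      then show False
        using * assms by simp
    qed
    with * show ?A
      by (intro bexI[of _ "Suc i"] exI[of _ q]) (simp_all add: block_start_eq_total_size)
  qed
  then show ?thesis
    using assms by (simp add: N_Er_def shift_entry_def)
qed

lemma shift_entry_eq_0: "c < p \<Longrightarrow> shift_entry l p c = 0"
  by (auto simp: shift_entry_def total_size_Suc)

lemma shift_entry_first:
  assumes "c < l 1"
  shows "shift_entry l p c = 0"
proof -
  have "total_size 1 l \<le> total_size (Suc i) l" for i
    by (rule total_size_mono) simp
  then have "l 1 \<le> total_size (Suc i) l" for i
    by (simp add: total_size_Suc[of 0 l])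
  then have "c < total_size (Suc i) l + q" for i q
    using assms by (meson order_less_le_trans trans_le_add1)
  then have "c \<noteq> total_size (Suc i) l + q" for i q
    by (metis less_irrefl)
  then show ?thesis
    by (simp add: shift_entry_def)
qed

text \<open>With 0-based block numbers: block \<open>i\<close> occupies the indices from \<open>total_size i l\<close> to
  \<open>total_size (Suc i) l - 1\<close> and has size \<open>l (Suc i)\<close>.\<close>

locale staircase = nontrivial_interval +
  fixes l :: "nat \<Rightarrow> nat" and \<mu> :: nat and N :: "nat \<Rightarrow> nat \<Rightarrow> real \<Rightarrow> real"
  assumes sizes: "Suc i < \<mu> \<Longrightarrow> l (Suc i) \<le> l (Suc (Suc i))"
    and N_zero: "t \<in> I \<Longrightarrow> i < \<mu> \<Longrightarrow> total_size i l \<le> r \<Longrightarrow> r < total_size \<mu> l \<Longrightarrow>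
      c < total_size (Suc i) l \<Longrightarrow> N r c t = 0"
    and N_indep: "t \<in> I \<Longrightarrow> Suc i < \<mu> \<Longrightarrow>
      (\<And>j. j < l (Suc (Suc i)) \<Longrightarrow>
        (\<Sum>p<l (Suc i). u p * N (total_size i l + p) (total_size (Suc i) l + j) t) = 0) \<Longrightarrow>
      p < l (Suc i) \<Longrightarrow> u p = 0"
begin

abbreviation "s i \<equiv> total_size i l"
abbreviation "e \<equiv> shift_entry l"

lemma s_le: "i \<le> \<mu> \<Longrightarrow> s i \<le> s \<mu>"
  by (rule total_size_mono)

lemma e_col:
  assumes i: "Suc i < \<mu>" and j: "j < l (Suc (Suc i))"
  shows "e p (s (Suc i) + j) = (if j < l (Suc i) \<and> p = s i + j then 1 else 0)"
proof -
  have "(\<exists>i' q. q < l (Suc i') \<and> p = s i' + q \<and> s (Suc i) + j = s (Suc i') + q) \<longleftrightarrow>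
      j < l (Suc i) \<and> p = s i + j" (is "?A \<longleftrightarrow> ?B")
  proof
    assume ?A
    then obtain i' q where *: "q < l (Suc i')" "p = s i' + q" "s (Suc i) + j = s (Suc i') + q"
      by blast
    have "Suc i' < \<mu>"
    proof (rule ccontr)
      assume "\<not> Suc i' < \<mu>"
      then have "s \<mu> \<le> s (Suc i')"
        by (intro total_size_mono) simp
      moreover have "s (Suc i) + j < s (Suc (Suc i))"
        using j by (simp add: total_size_Suc)
      moreover have "s (Suc (Suc i)) \<le> s \<mu>"
        using i by (intro s_le) simp
      ultimately show False
        using * by simp
    qed
    \<comment> \<open>Nondecreasing sizes make \<open>q\<close> a legal offset in the following
      block, so uniqueness of block positions applies.\<close>
    then have "q < l (Suc (Suc i'))"
      using *(1) sizes[of i'] by simp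
    then have "Suc (Suc i) = Suc (Suc i') \<and> j = q"
      using block_index_unique[of "Suc (Suc i)" "Suc (Suc i')" j l q] *(3) j
      by (simp add: block_start_eq_total_size)
    then show ?B
      using * by simp
  next
    assume ?B
    then show ?A
      by (intro exI[of _ i] exI[of _ j]) simp
  qed
  then show ?thesis
    by (simp add: shift_entry_def)
qed

text \<open>Right multiplication by the shift matrix moves each block column one place to the right
  and fills the additional columns with zeros.\<close>

lemma sum_e_col:
  assumes i: "Suc i < \<mu>" and j: "j < l (Suc (Suc i))" and n: "s (Suc i) \<le> n"
  shows "(\<Sum>p<n. f p * e p (s (Suc i) + j)) = (if j < l (Suc i) then f (s i + j) else 0)"
proof (cases "j < l (Suc i)")
  case True
  then have "s i + j < n"
    using n by (simp add: total_size_Suc)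
  have "(\<Sum>p<n. f p * e p (s (Suc i) + j)) = (\<Sum>p<n. f p * \<delta> p (s i + j))"
    unfolding e_col[OF i j] by (rule sum.cong) (simp_all add: True \<delta>_def)
  then show ?thesis
    using True \<open>s i + j < n\<close> by simp
qed (simp add: e_col[OF i j])

text \<open>The shift matrix is upper triangular, so appending blocks does not change its action on
  the columns already present.\<close>

lemma sum_e_low:
  assumes "c < a"
  shows "(\<Sum>p<a + b. f p * e p c) = (\<Sum>p<a. f p * e p c)"
  using assms by (simp add: sum_lessThan_add shift_entry_eq_0)

text \<open>Besides normalizing the superdiagonal block, this yields a smooth right inverse of it:
  the first \<open>l (Suc i)\<close> columns of \<open>W\<close>.\<close>

lemma superdiagonal_normal_form:
  assumes i: "Suc i < \<mu>" and k: "1 \<le> k"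
    and N: "\<And>r c. r < s \<mu> \<Longrightarrow> c < s \<mu> \<Longrightarrow> sm k (N r c)"
  obtains W where "\<And>p q. p < l (Suc (Suc i)) \<Longrightarrow> q < l (Suc (Suc i)) \<Longrightarrow> sm k (W p q)"
    "\<And>t. t \<in> I \<Longrightarrow> nonsing (l (Suc (Suc i))) (\<lambda>p q. W p q t)"
    "\<And>t p j. t \<in> I \<Longrightarrow> p < l (Suc i) \<Longrightarrow> j < l (Suc (Suc i)) \<Longrightarrow>
      (\<Sum>q<l (Suc (Suc i)). N (s i + p) (s (Suc i) + q) t * W q j t) = \<delta> p j"
proof -
  have bounds: "s (Suc i) \<le> s \<mu>" "s (Suc (Suc i)) \<le> s \<mu>"
    using i by (simp_all add: s_le)
  have "sm k (N (s i + p) (s (Suc i) + q))" if "p < l (Suc i)" "q < l (Suc (Suc i))" for p q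
    using that bounds by (intro N) (simp_all add: total_size_Suc)
  then show thesis
  proof (rule full_row_rank_normal_form[of k "l (Suc i)" "l (Suc (Suc i))"
        "\<lambda>p q. N (s i + p) (s (Suc i) + q)", OF k _ _ that])
    fix t u p
    assume "t \<in> I" "\<And>j. j < l (Suc (Suc i)) \<Longrightarrow>
      (\<Sum>p<l (Suc i). u p * N (s i + p) (s (Suc i) + j) t) = 0" "p < l (Suc i)"
    then show "u p = 0"
      by (intro N_indep[of t i u p] i)
  qed
qed

text \<open>Back substitution through the blocks. The last block row of the truncated
  \<open>N\<close> vanishes, which matches the zero right-hand side; the block row above it is
  solved by the last block of unknowns alone, and the remaining system has the same shape with one
  block fewer. No derivative is lost.\<close>

lemma solve_above_last_block:
  assumes k: "1 \<le> k" and N: "\<And>r c. r < s \<mu> \<Longrightarrow> c < s \<mu> \<Longrightarrow> sm k (N r c)"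
  shows "Suc m \<le> \<mu> \<Longrightarrow> (\<And>r. r < s (Suc m) \<Longrightarrow> sm k (f r)) \<Longrightarrow>
    (\<And>t r. t \<in> I \<Longrightarrow> s m \<le> r \<Longrightarrow> r < s (Suc m) \<Longrightarrow> f r t = 0) \<Longrightarrow>
    \<exists>y. (\<forall>r<s (Suc m). sm k (y r)) \<and>
      (\<forall>t\<in>I. \<forall>r<s (Suc m). (\<Sum>p<s (Suc m). N r p t * y p t) = f r t)"
proof (induction m arbitrary: f)
  case 0
  show ?case
    by (rule exI[of _ "\<lambda>_ _. 0"]) (use "0.prems"(3) in simp)
next
  case (Suc m)
  define a b where "a = s (Suc m)" and "b = l (Suc (Suc m))"
  have a: "a = s m + l (Suc m)" and ab: "s (Suc (Suc m)) = a + b"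
    by (simp_all add: a_def b_def total_size_Suc)
  have m: "Suc m < \<mu>"
    using Suc.prems(1) by simp
  have lb: "l (Suc m) \<le> b"
    using sizes[OF m] by (simp add: b_def)
  have ab_le: "a + b \<le> s \<mu>"
    using s_le[OF Suc.prems(1)] ab by simp
  obtain W where W: "\<And>p q. p < b \<Longrightarrow> q < b \<Longrightarrow> sm k (W p q)"
    and "\<And>t. t \<in> I \<Longrightarrow> nonsing b (\<lambda>p q. W p q t)"
    and NW: "\<And>t p j. t \<in> I \<Longrightarrow> p < l (Suc m) \<Longrightarrow> j < b \<Longrightarrow>
      (\<Sum>q<b. N (s m + p) (a + q) t * W q j t) = \<delta> p j"
    by (rule superdiagonal_normal_form[OF m k N that[unfolded a_def b_def]])
  \<comment> \<open>\<open>W\<close> applied to block \<open>m\<close> of \<open>f\<close> padded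
    with zeros, that is, the right inverse of the superdiagonal block.\<close>
  define z where "z q t = (\<Sum>i<l (Suc m). W q i t * f (s m + i) t)" for q t
  \<comment> \<open>The choice of \<open>z\<close> makes \<open>f'\<close> vanish on block
    \<open>m\<close>, as the induction hypothesis demands.\<close>
  define f' where "f' r t = f r t - (\<Sum>q<b. N r (a + q) t * z q t)" for r t
  have sz: "sm k (z q)" if "q < b" for q
    unfolding z_def using that lb
    by (intro smooth_on_sum smooth_on_mult W Suc.prems(2)) (auto simp: ab a)
  have Nz: "(\<Sum>q<b. N (s m + i) (a + q) t * z q t) = f (s m + i) t"
    if t: "t \<in> I" and i: "i < l (Suc m)" for t i
  proof -
    have "(\<Sum>q<b. N (s m + i) (a + q) t * z q t) =
        (\<Sum>j<l (Suc m). (\<Sum>q<b. N (s m + i) (a + q) t * W q j t) * f (s m + j) t)"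
      unfolding z_def by (rule sum_mult_assoc)
    also have "\<dots> = (\<Sum>j<l (Suc m). \<delta> i j * f (s m + j) t)"
      by (rule sum.cong) (use lb in \<open>simp_all add: NW[OF t i]\<close>)
    finally show ?thesis
      using i by simp
  qed
  have "\<exists>y. (\<forall>r<s (Suc m). sm k (y r)) \<and>
      (\<forall>t\<in>I. \<forall>r<s (Suc m). (\<Sum>p<s (Suc m). N r p t * y p t) = f' r t)"
  proof (rule Suc.IH)
    show "sm k (f' r)" if "r < s (Suc m)" for r
      unfolding f'_def using that ab_le
      by (intro smooth_on_diff smooth_on_sum smooth_on_mult N sz Suc.prems(2)) (auto simp: ab a_def)
    show "f' r t = 0" if "t \<in> I" "s m \<le> r" "r < s (Suc m)" for t r
      using Nz[OF that(1), of "r - s m"] that by (simp add: f'_def a_def[symmetric] a)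
  qed (use m in simp)
  then obtain y where sy: "\<forall>r<a. sm k (y r)" and y: "\<forall>t\<in>I. \<forall>r<a. (\<Sum>p<a. N r p t * y p t) = f' r t"
    unfolding a_def by (elim exE conjE)
  define y' where "y' p = (if p < a then y p else z (p - a))" for p
  have "(\<Sum>p<a + b. N r p t * y' p t) = f r t" if t: "t \<in> I" and r: "r < a + b" for t r
  proof (cases "r < a")
    case True
    have "(\<Sum>p<a. N r p t * y' p t) = f' r t"
      using y[rule_format, OF t True] by (simp add: y'_def)
    moreover have "(\<Sum>p<b. N r (a + p) t * y' (a + p) t) = (\<Sum>q<b. N r (a + q) t * z q t)"
      by (simp add: y'_def)
    ultimately show ?thesis
      unfolding sum_lessThan_add by (simp add: f'_def)
  next
    case False
    have "N r p t = 0" if "p < a + b" for p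
      by (rule N_zero[OF t m]) (use False r ab_le that in \<open>simp_all add: ab a_def[symmetric]\<close>)
    moreover have "f r t = 0"
      using Suc.prems(3)[OF t, of r] False r by (simp add: ab a_def[symmetric])
    ultimately show ?thesis
      by simp
  qed
  moreover have "sm k (y' r)" if "r < a + b" for r
    using sy[rule_format, of r] sz[of "r - a"] that by (simp add: y'_def)
  ultimately show ?case
    unfolding ab by blast
qed

text \<open>The regularity of the last diagonal block is carried along only for the induction, which uses it
  for \<open>Z\<close>; each new block column costs one derivative.\<close>

lemma exists_chain_transformation:
  assumes N: "\<And>r c. r < s \<mu> \<Longrightarrow> c < s \<mu> \<Longrightarrow> sm (k + enat m) (N r c)"
    and k: "1 \<le> k" and m: "Suc m \<le> \<mu>"
  shows "\<exists>K. (\<forall>r<s (Suc m). \<forall>c<s (Suc m). sm k (K r c)) \<and>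
    (\<forall>t\<in>I.
      (\<forall>r<s (Suc m). \<forall>c<s (Suc m). (\<Sum>p<s (Suc m). N r p t * K p c t) =
        (\<Sum>p<s (Suc m). N r p t * (\<Sum>q<s (Suc m). D (K p q) t * e q c)) +
        (\<Sum>q<s (Suc m). K r q t * e q c)) \<and>
      nonsing (s (Suc m)) (\<lambda>r c. K r c t) \<and>
      nonsing (s (Suc m)) (\<lambda>r c. K r c t + (\<Sum>p<s (Suc m). N r p t * D (K p c) t)) \<and>
      nonsing (l (Suc m)) (\<lambda>i j. K (s m + i) (s m + j) t))"
  using N k m
proof (induction m arbitrary: k)
  case 0
  have s1: "s (Suc 0) = l 1"
    by (simp add: total_size_Suc)
  have e0: "e q c = 0" if "c < s (Suc 0)" for q c
    using that by (intro shift_entry_first) (simp add: s1)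
  have N0: "N r c t = 0" if "t \<in> I" "r < s (Suc 0)" "c < s (Suc 0)" for t r c
    by (rule N_zero[of t 0]) (use that 0 s_le[of "Suc 0"] in simp_all)
  show ?case
    \<comment> \<open>On a single block both \<open>N\<close> and the shift matrix vanish, so the
      identity works.\<close>
    by (rule exI[of _ "\<lambda>i j _. \<delta> i j"]) (simp add: e0 N0 nonsing_delta s1)
next
  case (Suc m)
  define a b where "a = s (Suc m)" and "b = l (Suc (Suc m))"
  have a: "a = s m + l (Suc m)" and ab: "s (Suc (Suc m)) = a + b"
    by (simp_all add: a_def b_def total_size_Suc)
  have m: "Suc m < \<mu>"
    using Suc.prems(3) by simp
  have lb: "l (Suc m) \<le> b"
    using sizes[OF m] by (simp add: b_def)
  have ab_le: "a + b \<le> s \<mu>"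
    using s_le[OF Suc.prems(3)] ab by simp
  have k_Suc: "k + 1 + enat m = k + enat (Suc m)"
    by (simp add: one_enat_def add.assoc)
  have N: "sm k (N r c)" if "r < s \<mu>" "c < s \<mu>" for r c
    using Suc.prems(1)[OF that] by (rule smooth_on_mono) simp
  \<comment> \<open>The hypothesis is taken at order \<open>k + 1\<close>, so that the derivative of
    \<open>K\<close> is still of class \<open>k\<close> when it enters the new column.\<close>
  have "\<exists>K. (\<forall>r<a. \<forall>c<a. sm (k + 1) (K r c)) \<and>
    (\<forall>t\<in>I.
      (\<forall>r<a. \<forall>c<a. (\<Sum>p<a. N r p t * K p c t) =
        (\<Sum>p<a. N r p t * (\<Sum>q<a. D (K p q) t * e q c)) + (\<Sum>q<a. K r q t * e q c)) \<and>
      nonsing a (\<lambda>r c. K r c t) \<and>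
      nonsing a (\<lambda>r c. K r c t + (\<Sum>p<a. N r p t * D (K p c) t)) \<and>
      nonsing (l (Suc m)) (\<lambda>i j. K (s m + i) (s m + j) t))"
    unfolding a_def
  proof (rule Suc.IH)
    show "sm (k + 1 + enat m) (N r c)" if "r < s \<mu>" "c < s \<mu>" for r c
      using Suc.prems(1)[OF that] by (simp only: k_Suc)
    show "1 \<le> k + 1" "Suc m \<le> \<mu>"
      using m by simp_all
  qed
  then obtain K where "\<forall>r<a. \<forall>c<a. sm (k + 1) (K r c)"
    and IH: "\<forall>t\<in>I.
      (\<forall>r<a. \<forall>c<a. (\<Sum>p<a. N r p t * K p c t) =
        (\<Sum>p<a. N r p t * (\<Sum>q<a. D (K p q) t * e q c)) + (\<Sum>q<a. K r q t * e q c)) \<and>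
      nonsing a (\<lambda>r c. K r c t) \<and>
      nonsing a (\<lambda>r c. K r c t + (\<Sum>p<a. N r p t * D (K p c) t)) \<and>
      nonsing (l (Suc m)) (\<lambda>i j. K (s m + i) (s m + j) t)"
    by (elim exE conjE)
  then have sK1: "sm (k + 1) (K r c)" if "r < a" "c < a" for r c
    using that by simp
  have sK: "sm k (K r c)" if "r < a" "c < a" for r c
    using sK1[OF that] by (rule smooth_on_mono) simp
  have sDK: "sm k (D (K r c))" if "r < a" "c < a" for r c
    using sK1[OF that] by (rule smooth_D)
  obtain W where W: "\<And>p q. p < b \<Longrightarrow> q < b \<Longrightarrow> sm k (W p q)"
    and nW: "\<And>t. t \<in> I \<Longrightarrow> nonsing b (\<lambda>p q. W p q t)"
    and NW: "\<And>t p j. t \<in> I \<Longrightarrow> p < l (Suc m) \<Longrightarrow> j < b \<Longrightarrow>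
      (\<Sum>q<b. N (s m + p) (a + q) t * W q j t) = \<delta> p j"
    by (rule superdiagonal_normal_form[OF m Suc.prems(2) N that[unfolded a_def b_def]])
  \<comment> \<open>The last diagonal block of \<open>K\<close> extended by an identity. Then
    \<open>Z = W M\<close> is nonsingular, and the superdiagonal block of \<open>N\<close> times
    \<open>Z\<close> is \<open>[I 0] M\<close>, the last diagonal block of \<open>K\<close> padded
    with zeros.\<close>
  define M where "M p j = (if p < l (Suc m) \<and> j < l (Suc m) then K (s m + p) (s m + j) else (\<lambda>_. \<delta> p j))"
    for p j
  define Z where "Z i j t = (\<Sum>p<b. W i p t * M p j t)" for i j t
  \<comment> \<open>The right-hand side left for the upper part of the new column after the
    contribution of \<open>Z\<close> has been moved over. The choice of \<open>Z\<close> makes it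
    vanish on block \<open>m\<close>.\<close>
  define f where "f j r t = (if j < l (Suc m) then K r (s m + j) t else 0) - (\<Sum>q<b. N r (a + q) t * Z q j t)"
    for j r t
  have sM: "sm k (M p j)" for p j
    unfolding M_def by (auto intro!: sK simp: a)
  have sZ: "sm k (Z i j)" if "i < b" for i j
    unfolding Z_def using that by (intro smooth_on_sum smooth_on_mult W sM) auto
  have sf: "sm k (f j r)" if "r < a" for j r
  proof -
    have "sm k (\<lambda>t. if j < l (Suc m) then K r (s m + j) t else 0)"
      using that by (cases "j < l (Suc m)") (auto intro!: sK simp: a)
    then show ?thesis
      unfolding f_def using that ab_le by (intro smooth_on_diff smooth_on_sum smooth_on_mult N sZ) auto
  qed
  have nZ: "nonsing b (\<lambda>i j. Z i j t)" if t: "t \<in> I" for t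
  proof -
    have "nonsing (l (Suc m) + (b - l (Suc m))) (\<lambda>i j. M i j t)"
      by (rule nonsing_block_upper[of _ "\<lambda>i j. K (s m + i) (s m + j) t" _ \<delta>])
        (use IH t in \<open>simp_all add: M_def nonsing_delta, simp_all add: \<delta>_def\<close>)
    then have "nonsing b (\<lambda>i j. M i j t)"
      using lb by simp
    then show ?thesis
      unfolding Z_def by (rule nonsing_mult[OF nW[OF t]])
  qed
  have NZ: "(\<Sum>q<b. N (s m + i) (a + q) t * Z q j t) = M i j t"
    if t: "t \<in> I" and i: "i < l (Suc m)" for t i j
  proof -
    have "(\<Sum>q<b. N (s m + i) (a + q) t * Z q j t) =
        (\<Sum>p<b. (\<Sum>q<b. N (s m + i) (a + q) t * W q p t) * M p j t)"
      unfolding Z_def by (rule sum_mult_assoc)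
    also have "\<dots> = (\<Sum>p<b. \<delta> i p * M p j t)"
      by (rule sum.cong) (simp_all add: NW[OF t i])
    finally show ?thesis
      using i lb by simp
  qed
  have f0: "f j r t = 0" if "t \<in> I" "s m \<le> r" "r < a" for j r t
  proof -
    have r: "r = s m + (r - s m)" "r - s m < l (Suc m)"
      using that by (simp_all add: a)
    have "f j (s m + (r - s m)) t = 0"
      unfolding f_def NZ[OF that(1) r(2)] using r(2) by (auto simp: M_def \<delta>_def)
    then show ?thesis
      using r(1) by simp
  qed
  have "\<exists>y. (\<forall>r<a. sm k (y r)) \<and> (\<forall>t\<in>I. \<forall>r<a. (\<Sum>p<a. N r p t * y p t) = f j r t)" for j
    unfolding a_def
    by (rule solve_above_last_block[OF Suc.prems(2) N]) (use m sf f0 in \<open>simp_all add: a_def\<close>)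
  then have "\<exists>Y. \<forall>j. (\<forall>r<a. sm k (Y j r)) \<and> (\<forall>t\<in>I. \<forall>r<a. (\<Sum>p<a. N r p t * Y j p t) = f j r t)"
    by (intro choice allI)
  then obtain Y where Y: "\<forall>j. (\<forall>r<a. sm k (Y j r)) \<and> (\<forall>t\<in>I. \<forall>r<a. (\<Sum>p<a. N r p t * Y j p t) = f j r t)"
    by (elim exE)
  \<comment> \<open>The shift brings the last old block column into the new one, so only derivatives
    of the old \<open>K\<close> occur in the equation for the new column. Adding them to
    \<open>Y\<close> cancels the derivative term.\<close>
  define X where "X r j t = Y j r t + (if j < l (Suc m) then D (K r (s m + j)) t else 0)" for r j t
  have sX: "sm k (X r j)" if "r < a" for r j
  proof -
    have "sm k (\<lambda>t. if j < l (Suc m) then D (K r (s m + j)) t else 0)"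
      using that by (cases "j < l (Suc m)") (auto intro!: sDK simp: a)
    then show ?thesis
      unfolding X_def using that Y by (intro smooth_on_add) auto
  qed
  \<comment> \<open>In block form \<open>K' = [K X; 0 Z]\<close>.\<close>
  define K' where "K' r c = (if c < a then if r < a then K r c else (\<lambda>_. 0)
      else if r < a then X r (c - a) else Z (r - a) (c - a))" for r c
  \<comment> \<open>The last block row of the truncated \<open>N\<close> is zero. Hence
    \<open>K'\<close> plus \<open>N\<close> times its derivative is again block upper triangular,
    with the old matrix of this kind and \<open>Z\<close> on the diagonal.\<close>
  have N_low: "N r p t = 0" if "t \<in> I" "a \<le> r" "r < a + b" "p < a + b" for r p t
    by (rule N_zero[OF that(1) m]) (use that ab_le in \<open>simp_all add: ab a_def[symmetric]\<close>)
  have eq: "(\<Sum>p<a + b. N r p t * K' p c t) =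
        (\<Sum>p<a + b. N r p t * (\<Sum>q<a + b. D (K' p q) t * e q c)) + (\<Sum>q<a + b. K' r q t * e q c)"
    if t: "t \<in> I" and r: "r < a + b" and c: "c < a + b" for t r c
  proof (cases "c < a")
    case True
    have K'e: "(\<Sum>q<a + b. g q * e q c) = (\<Sum>q<a. g q * e q c)" for g
      by (rule sum_e_low[OF True])
    show ?thesis
    proof (cases "r < a")
      case ra: True
      show ?thesis
        unfolding K'e unfolding sum_lessThan_add
        using IH[rule_format, OF t, THEN conjunct1, rule_format, OF ra True] True ra t
        by (simp add: K'_def)
    next
      case False
      then show ?thesis
        unfolding K'e using N_low[OF t _ r] by (simp add: K'_def)
    qed
  next
    case False
    define j where "j = c - a"
    have j: "c = a + j" "j < b"
      using False c by (simp_all add: j_def)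
    have K'e: "(\<Sum>q<a + b. g q * e q c) = (if j < l (Suc m) then g (s m + j) else 0)" for g
      unfolding j(1) a_def by (rule sum_e_col[OF m j(2)[unfolded b_def]]) simp
    show ?thesis
    proof (cases "r < a")
      case ra: True
      have "(\<Sum>p<a + b. N r p t * K' p c t) =
          (\<Sum>p<a. N r p t * X p j t) + (\<Sum>q<b. N r (a + q) t * Z q j t)"
        unfolding sum_lessThan_add using j by (simp add: K'_def)
      also have "(\<Sum>p<a. N r p t * X p j t) =
          f j r t + (\<Sum>p<a. N r p t * (if j < l (Suc m) then D (K p (s m + j)) t else 0))"
        using Y ra t by (simp add: X_def distrib_left sum.distrib)
      also have "(\<Sum>p<a. N r p t * (if j < l (Suc m) then D (K p (s m + j)) t else 0)) =
          (\<Sum>p<a + b. N r p t * (if j < l (Suc m) then D (K' p (s m + j)) t else 0))"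
        unfolding sum_lessThan_add using t by (cases "j < l (Suc m)") (simp_all add: K'_def a)
      also have "f j r t = (if j < l (Suc m) then K' r (s m + j) t else 0) - (\<Sum>q<b. N r (a + q) t * Z q j t)"
        using ra by (simp add: f_def K'_def a)
      finally show ?thesis
        unfolding K'e by simp
    next
      case False
      then show ?thesis
        unfolding K'e using N_low[OF t _ r] by (simp add: K'_def a)
    qed
  qed
  have nonsing: "nonsing (a + b) (\<lambda>r c. K' r c t)" if t: "t \<in> I" for t
    by (rule nonsing_block_upper[OF _ nZ[OF t], of a "\<lambda>r c. K r c t"])
      (use IH t in \<open>simp_all add: K'_def\<close>)
  have nonsing': "nonsing (a + b) (\<lambda>r c. K' r c t + (\<Sum>p<a + b. N r p t * D (K' p c) t))"
    if t: "t \<in> I" for t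
  proof (rule nonsing_block_upper[OF _ nZ[OF t],
        of a "\<lambda>r c. K r c t + (\<Sum>p<a. N r p t * D (K p c) t)"])
    show "nonsing a (\<lambda>r c. K r c t + (\<Sum>p<a. N r p t * D (K p c) t))"
      using IH t by blast
    show "K' i j t + (\<Sum>p<a + b. N i p t * D (K' p j) t) = K i j t + (\<Sum>p<a. N i p t * D (K p j) t)"
      if "i < a" "j < a" for i j
      unfolding sum_lessThan_add using that t by (simp add: K'_def)
    show "K' (a + i) j t + (\<Sum>p<a + b. N (a + i) p t * D (K' p j) t) = 0" if "i < b" "j < a" for i j
      using that N_low[OF t, of "a + i"] by (simp add: K'_def)
    show "K' (a + i) (a + j) t + (\<Sum>p<a + b. N (a + i) p t * D (K' p (a + j)) t) = Z i j t"
      if "i < b" "j < b" for i j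
      using that N_low[OF t, of "a + i"] by (simp add: K'_def)
  qed
  have smooth: "sm k (K' r c)" if "r < a + b" for r c
    using that by (auto simp: K'_def intro!: sK sX sZ)
  have diag: "nonsing b (\<lambda>i j. K' (a + i) (a + j) t)" if "t \<in> I" for t
    using nZ[OF that] by (simp add: K'_def)
  show ?case
    unfolding ab a_def[symmetric] b_def[symmetric]
    by (intro exI[of _ K'] conjI ballI allI impI)
      (assumption | rule smooth eq nonsing nonsing' diag)+
qed

end

section \<open>Equivalence with the constant nilpotent part\<close>

text \<open>Rank \<open>nr\<close> provides \<open>nr\<close> independent columns, which form an
  invertible square matrix. A linear relation among the rows of \<open>M\<close> is also one among
  the rows of this square matrix, hence trivial.\<close>

lemma full_rank_rows_independent:
  fixes M :: "real mat"
  assumes M: "M \<in> carrier_mat nr nc" and rank: "vec_space.rank nr M = nr"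
    and u: "\<And>j. j < nc \<Longrightarrow> (\<Sum>i<nr. u i * M $$ (i, j)) = 0" and i: "i < nr"
  shows "u i = 0"
proof -
  interpret vec_space "TYPE(real)" nr .
  have "\<exists>S. maximal S (\<lambda>T. T \<subseteq> set (cols M) \<and> lin_indpt T)"
    using maximal_exists[of "(\<lambda>T. T \<subseteq> set (cols M) \<and> lin_indpt T)" "card (set (cols M))" "{}"]
    by (meson List.finite_set card_mono empty_iff empty_subsetI finite_lin_indpt2 rev_finite_subset)
  then obtain S where S: "maximal S (\<lambda>T. T \<subseteq> set (cols M) \<and> lin_indpt T)"
    by (rule exE)
  then have S': "S \<subseteq> set (cols M)" "lin_indpt S"
    by (simp_all add: maximal_def)
  have "finite S"
    using S'(1) by (rule finite_subset) simp
  then obtain vs where vs: "set vs = S" "distinct vs"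
    using finite_distinct_list by blast
  have "card S = nr"
    using rank_card_indpt[OF M S] rank by simp
  then have len: "length vs = nr"
    using vs distinct_card by force
  have carrier: "set vs \<subseteq> carrier_vec nr"
    using S'(1) vs(1) cols_dim[of M] M by auto
  define A where "A = mat_of_cols nr vs"
  have A: "A \<in> carrier_mat nr nr" and cols: "cols A = vs"
    using mat_of_cols_carrier(1)[of nr vs] len carrier by (simp_all add: A_def)
  have "rank A = nr"
    by (rule lin_indpt_full_rank[OF A]) (simp_all add: cols vs S')
  then have "det A \<noteq> 0"
    using det_rank_iff[OF A] by simp
  moreover have "mat nr nr (\<lambda>(i, j). A $$ (i, j)) = A"
    by (rule eq_matI) (use A in auto)
  ultimately have "nonsing nr (\<lambda>i j. A $$ (i, j))"
    by (simp add: nonsing_iff_det)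
  then have ns: "nonsing nr (\<lambda>j i. A $$ (i, j))"
    by (rule iffD2[OF nonsing_transpose])
  have "(\<Sum>i<nr. A $$ (i, j) * u i) = 0" if j: "j < nr" for j
  proof -
    have "vs ! j \<in> set (cols M)"
      using S'(1) vs(1) len j nth_mem[of j vs] by blast
    then obtain j' where j': "j' < nc" "vs ! j = col M j'"
      using M by (auto simp: cols_def)
    have "(\<Sum>i<nr. A $$ (i, j) * u i) = (\<Sum>i<nr. u i * M $$ (i, j'))"
      by (rule sum.cong) (use M j' len j in \<open>auto simp: A_def mat_of_cols_index\<close>)
    then show ?thesis
      using u[OF j'(1)] by simp
  qed
  from nonsingD[OF ns this i] show ?thesis .
qed

section \<open>Smooth inverses of matrix functions\<close>

lemma adj_mat_inverse:
  fixes A :: "real mat"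
  assumes A: "A \<in> carrier_mat n n" and det: "det A \<noteq> 0"
  shows "A * ((1 / det A) \<cdot>\<^sub>m adj_mat A) = 1\<^sub>m n" "(1 / det A) \<cdot>\<^sub>m adj_mat A * A = 1\<^sub>m n"
proof -
  note adj = adj_mat[OF A]
  have one: "(1 / det A) \<cdot>\<^sub>m (det A \<cdot>\<^sub>m 1\<^sub>m n) = 1\<^sub>m n"
    by (rule eq_matI) (use det in auto)
  show "A * ((1 / det A) \<cdot>\<^sub>m adj_mat A) = 1\<^sub>m n"
    unfolding mult_smult_distrib[OF A adj(1)] adj(2) by (rule one)
  show "(1 / det A) \<cdot>\<^sub>m adj_mat A * A = 1\<^sub>m n"
    unfolding mult_smult_assoc_mat[OF adj(1) A] adj(3) by (rule one)
qed

lemma invertible_mat_if_det: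
  fixes A :: "real mat"
  assumes A: "A \<in> carrier_mat n n" and det: "det A \<noteq> 0"
  shows "invertible_mat A"
  unfolding invertible_mat_def
proof (intro conjI exI)
  show "square_mat A"
    using A by simp
  show "inverts_mat A ((1 / det A) \<cdot>\<^sub>m adj_mat A)"
    using adj_mat_inverse(1)[OF A det] A by (simp add: inverts_mat_def)
  show "inverts_mat ((1 / det A) \<cdot>\<^sub>m adj_mat A) A"
    using adj_mat_inverse(2)[OF A det] adj_mat(1)[OF A] by (simp add: inverts_mat_def)
qed

text \<open>By the Leibniz formula the determinant is a polynomial in the entries.\<close>

lemma smooth_on_det:
  assumes "\<And>i j. i < m \<Longrightarrow> j < m \<Longrightarrow> smooth_on k I (A i j)"
  shows "smooth_on k I (\<lambda>t. det (mat m m (\<lambda>(i, j). A i j t)))"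
proof -
  have p: "p i < m" if "p permutes {0..<m}" "i < m" for p i
    using permutes_in_image[OF that(1), of i] that(2) by simp
  have "det (mat m m (\<lambda>(i, j). A i j t)) =
      (\<Sum>p\<in>{p. p permutes {0..<m}}. signof p * (\<Prod>i = 0..<m. A i (p i) t))" for t
    by (subst det_def'[of _ m]) (simp_all add: p)
  moreover have "smooth_on k I (\<lambda>t. \<Sum>p\<in>{p. p permutes {0..<m}}. signof p * (\<Prod>i = 0..<m. A i (p i) t))"
    by (intro smooth_on_sum smooth_on_mult smooth_on_prod smooth_on_const assms) (simp_all add: p)
  ultimately show ?thesis
    by simp
qed

text \<open>The adjugate formula writes the inverse with cofactors divided by the nowhere vanishing
  determinant, so it is as smooth as the matrix.\<close>

lemma smooth_left_inverse:
  assumes A: "\<And>i j. i < m \<Longrightarrow> j < m \<Longrightarrow> smooth_on k I (A i j)"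
    and ns: "\<And>t. t \<in> I \<Longrightarrow> nonsing m (\<lambda>i j. A i j t)"
  obtains H where "\<And>i j. i < m \<Longrightarrow> j < m \<Longrightarrow> smooth_on k I (H i j)"
    "\<And>t. t \<in> I \<Longrightarrow> mat m m (\<lambda>(i, j). H i j t) * mat m m (\<lambda>(i, j). A i j t) = 1\<^sub>m m"
proof -
  define M where "M t = mat m m (\<lambda>(i, j). A i j t)" for t
  have M: "M t \<in> carrier_mat m m" for t
    by (simp add: M_def)
  have det: "det (M t) \<noteq> 0" if "t \<in> I" for t
    using ns[OF that] by (simp add: nonsing_iff_det M_def)
  define H where "H i j t = 1 / det (M t) * ((- 1) ^ (j + i) * det (mat_delete (M t) j i))" for i j t
  show thesis
  proof (rule that[of H])
    fix i j assume ij: "i < m" "j < m"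
    \<comment> \<open>The minor is rewritten with indices that skip the deleted row and column,
      which exhibits it as a determinant of smooth entries.\<close>
    have "mat_delete (M t) j i = mat (m - 1) (m - 1) (\<lambda>(i', j').
        A (if i' < j then i' else Suc i') (if j' < i then j' else Suc j') t)" for t
      by (rule eq_matI) (auto simp: mat_delete_def M_def)
    moreover have "smooth_on k I (\<lambda>t. det (mat (m - 1) (m - 1) (\<lambda>(i', j').
        A (if i' < j then i' else Suc i') (if j' < i then j' else Suc j') t)))"
      by (rule smooth_on_det) (auto intro!: A)
    moreover have "smooth_on k I (\<lambda>t. det (M t))"
      unfolding M_def by (rule smooth_on_det[OF A])
    ultimately show "smooth_on k I (H i j)"
      unfolding H_def using det
      by (intro smooth_on_mult smooth_on_divide smooth_on_const) simp_all
  next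
    fix t assume t: "t \<in> I"
    have "mat m m (\<lambda>(i, j). H i j t) = (1 / det (M t)) \<cdot>\<^sub>m adj_mat (M t)"
      by (rule eq_matI) (auto simp: H_def adj_mat_def cofactor_def M_def)
    also have "\<dots> * M t = 1\<^sub>m m"
      by (rule adj_mat_inverse(2)[OF M det[OF t]])
    finally show "mat m m (\<lambda>(i, j). H i j t) * mat m m (\<lambda>(i, j). A i j t) = 1\<^sub>m m"
      by (simp only: M_def)
  qed
qed

section \<open>Elimination of the off-diagonal block\<close>

context nontrivial_interval
begin

text \<open>This solves \<open>B = E + (\<Omega> B + B') N\<close> for strictly upper triangular
  \<open>N\<close>. Column \<open>c\<close> involves only the columns \<open>p < c\<close> of
  \<open>B\<close> and their derivatives, so it can be defined recursively; each column costs one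
  order, whence \<open>k + enat n\<close>.\<close>

lemma exists_decoupling:
  assumes "\<And>r q. r < d \<Longrightarrow> q < d \<Longrightarrow> sm (k + enat n) (\<Omega> r q)"
    and "\<And>r c. r < d \<Longrightarrow> c < n \<Longrightarrow> sm (k + enat n) (E r c)"
    and "\<And>p c. p < n \<Longrightarrow> c < n \<Longrightarrow> sm (k + enat n) (N p c)"
  shows "\<exists>B. (\<forall>r<d. \<forall>c<n. sm k (B r c)) \<and>
    (\<forall>r<d. \<forall>c<n. \<forall>t. B r c t =
      E r c t + (\<Sum>p<c. ((\<Sum>q<d. \<Omega> r q t * B q p t) + D (B r p) t) * N p c t))"
  using assms
proof (induction n arbitrary: k)
  case 0
  show ?case by simp
next
  case (Suc n)
  have k_Suc: "k + 1 + enat n = k + enat (Suc n)"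
    by (simp add: one_enat_def add.assoc)
  have "\<exists>B. (\<forall>r<d. \<forall>c<n. sm (k + 1) (B r c)) \<and>
    (\<forall>r<d. \<forall>c<n. \<forall>t. B r c t =
      E r c t + (\<Sum>p<c. ((\<Sum>q<d. \<Omega> r q t * B q p t) + D (B r p) t) * N p c t))"
    by (rule Suc.IH) (use Suc.prems in \<open>simp_all add: k_Suc\<close>)
  then obtain B where sB: "\<forall>r<d. \<forall>c<n. sm (k + 1) (B r c)"
    and B: "\<forall>r<d. \<forall>c<n. \<forall>t. B r c t =
      E r c t + (\<Sum>p<c. ((\<Sum>q<d. \<Omega> r q t * B q p t) + D (B r p) t) * N p c t)"
    by (elim exE conjE)
  \<comment> \<open>Column \<open>n\<close> is appended by the recursion formula; earlier columns
    are kept, so their equations persist.\<close>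
  define B' where "B' r c = (if c < n then B r c else
      (\<lambda>t. E r n t + (\<Sum>p<n. ((\<Sum>q<d. \<Omega> r q t * B q p t) + D (B r p) t) * N p n t)))" for r c
  have sB1: "sm (k + 1) (B r c)" if "r < d" "c < n" for r c
    using sB that by simp
  have sB0: "sm k (B r c)" if "r < d" "c < n" for r c
    using sB1[OF that] by (rule smooth_on_mono) simp
  have s: "sm k (\<Omega> r q)" if "r < d" "q < d" for r q
    using Suc.prems(1)[OF that] by (rule smooth_on_mono) simp
  have sE: "sm k (E r c)" if "r < d" "c < Suc n" for r c
    using Suc.prems(2)[OF that] by (rule smooth_on_mono) simp
  have sN: "sm k (N r c)" if "r < Suc n" "c < Suc n" for r c
    using Suc.prems(3)[OF that] by (rule smooth_on_mono) simp
  have new: "sm k (\<lambda>t. E r n t + (\<Sum>p<n. ((\<Sum>q<d. \<Omega> r q t * B q p t) + D (B r p) t) * N p n t))"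
    if "r < d" for r
    using that by (intro smooth_on_add smooth_on_sum smooth_on_mult s sE sN sB0 smooth_D sB1) auto
  have B'_eq: "B' q p = B q p" if "p < c" "c < Suc n" for q p c
    using that by (simp add: B'_def)
  show ?case
  proof (intro exI[of _ B'] conjI allI impI)
    show "sm k (B' r c)" if "r < d" "c < Suc n" for r c
      using new[OF that(1)] sB0[OF that(1)] by (simp add: B'_def)
    fix r c t assume r: "r < d" and c: "c < Suc n"
    have "(\<Sum>p<c. ((\<Sum>q<d. \<Omega> r q t * B' q p t) + D (B' r p) t) * N p c t) =
        (\<Sum>p<c. ((\<Sum>q<d. \<Omega> r q t * B q p t) + D (B r p) t) * N p c t)"
      by (rule sum.cong) (simp_all add: B'_eq[OF _ c])
    moreover have "B' r c t = E r c t + (\<Sum>p<c. ((\<Sum>q<d. \<Omega> r q t * B q p t) + D (B r p) t) * N p c t)"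
    proof (cases "c < n")
      case True
      then have "B' r c t = B r c t"
        by (simp add: B'_def)
      also note B[rule_format, OF r True]
      finally show ?thesis .
    next
      case False
      then have "c = n"
        using c by simp
      then show ?thesis
        by (simp add: B'_def)
    qed
    ultimately show "B' r c t =
        E r c t + (\<Sum>p<c. ((\<Sum>q<d. \<Omega> r q t * B' q p t) + D (B' r p) t) * N p c t)"
      by simp
  qed
qed

end

text \<open>The algebra at a fixed \<open>t\<close>. Primed matrices stand for derivatives; in
  particular the upper right block of \<open>K'\<close> is the product rule applied to
  \<open>- (B * K2)\<close>.\<close>

lemma block_equivalence:
  fixes A B B' K2 K2' L2 N \<Omega> :: "real mat"
  assumes c: "A \<in> carrier_mat d a" "B \<in> carrier_mat d a" "B' \<in> carrier_mat d a" "E \<in> carrier_mat d a"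
    "K2 \<in> carrier_mat a a" "K2' \<in> carrier_mat a a" "L2 \<in> carrier_mat a a" "N \<in> carrier_mat a a"
    "S \<in> carrier_mat a a" "\<Omega> \<in> carrier_mat d d"
    and A: "A = \<Omega> * B + B'" and B: "B = E + A * N"
    and L2: "L2 * (K2 + N * K2') = 1\<^sub>m a" and NK2: "N * K2 = N * (K2' * S) + K2 * S"
  defines "L \<equiv> four_block_mat (1\<^sub>m d) A (0\<^sub>m a d) L2"
    and "K \<equiv> four_block_mat (1\<^sub>m d) (- (B * K2)) (0\<^sub>m a d) K2"
    and "K' \<equiv> four_block_mat (0\<^sub>m d d) (- (B' * K2 + B * K2')) (0\<^sub>m a d) K2'"
  shows "L * four_block_mat (1\<^sub>m d) E (0\<^sub>m a d) N * K = four_block_mat (1\<^sub>m d) (0\<^sub>m d a) (0\<^sub>m a d) S"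
    and "L * four_block_mat \<Omega> (0\<^sub>m d a) (0\<^sub>m a d) (1\<^sub>m a) * K +
      L * four_block_mat (1\<^sub>m d) E (0\<^sub>m a d) N * K' =
      four_block_mat \<Omega> (0\<^sub>m d a) (0\<^sub>m a d) (1\<^sub>m a)"
proof -
  have LN: "L2 * N \<in> carrier_mat a a" and NK2': "N * K2' \<in> carrier_mat a a"
    and BK2: "B * K2 \<in> carrier_mat d a" and BK2': "B * K2' \<in> carrier_mat d a"
    and B'K2: "B' * K2 \<in> carrier_mat d a"
    using c by auto
  have uminus_0: "- 0\<^sub>m nr nc = (0\<^sub>m nr nc :: real mat)" for nr nc
    by (rule eq_matI) auto
  note c' = c LN NK2' BK2 BK2' B'K2
  have "1\<^sub>m d * E + A * N = B" "0\<^sub>m a d * E + L2 * N = L2 * N"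
    "1\<^sub>m d * 1\<^sub>m d + A * 0\<^sub>m a d = 1\<^sub>m d" "0\<^sub>m a d * 1\<^sub>m d + L2 * 0\<^sub>m a d = 0\<^sub>m a d"
    using B c LN by (simp_all add: left_add_zero_mat[OF LN])
  then have LE: "L * four_block_mat (1\<^sub>m d) E (0\<^sub>m a d) N = four_block_mat (1\<^sub>m d) B (0\<^sub>m a d) (L2 * N)"
    unfolding L_def
    by (subst mult_four_block_mat[of _ d d _ a _ a _ _ d _ a]) (use c in simp_all)
  \<comment> \<open>The equation for \<open>N * K2\<close> factors as
    \<open>(K2 + N * K2') * S\<close>, and \<open>L2\<close> inverts the first factor.\<close>
  have "L2 * N * K2 = L2 * (N * K2)"
    by (rule assoc_mult_mat[OF c(7,8,5)])
  also have "N * K2 = N * K2' * S + K2 * S"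
    unfolding NK2 assoc_mult_mat[OF c(8,6,9)] ..
  also have "\<dots> = (N * K2' + K2) * S"
    by (rule add_mult_distrib_mat[OF NK2' c(5,9), symmetric])
  also have "N * K2' + K2 = K2 + N * K2'"
    by (rule comm_add_mat[OF NK2' c(5)])
  also have "L2 * ((K2 + N * K2') * S) = L2 * (K2 + N * K2') * S"
    by (rule assoc_mult_mat[OF c(7) _ c(9), symmetric]) (use NK2' in simp)
  also have "\<dots> = S"
    unfolding L2 using c(9) by (rule left_mult_one_mat)
  finally have LNK: "L2 * N * K2 = S" .
  have "- (B * K2) + B * K2 = 0\<^sub>m d a"
    by (rule uminus_l_inv_mat[OF BK2])
  then have e: "1\<^sub>m d * - (B * K2) + B * K2 = 0\<^sub>m d a" "0\<^sub>m a d * - (B * K2) + L2 * N * K2 = S"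
    "1\<^sub>m d * 1\<^sub>m d + B * 0\<^sub>m a d = 1\<^sub>m d" "0\<^sub>m a d * 1\<^sub>m d + L2 * N * 0\<^sub>m a d = 0\<^sub>m a d"
    using c' by (simp_all add: LNK uminus_0 left_mult_one_mat[of _ d a] left_mult_zero_mat[of _ d a])
  show "L * four_block_mat (1\<^sub>m d) E (0\<^sub>m a d) N * K = four_block_mat (1\<^sub>m d) (0\<^sub>m d a) (0\<^sub>m a d) S"
    unfolding LE K_def mult_four_block_mat[OF one_carrier_mat c(2) zero_carrier_mat LN
        one_carrier_mat uminus_carrier_mat[OF BK2] zero_carrier_mat c(5)] e ..
  have "L2 * K2 + L2 * N * K2' = L2 * (K2 + N * K2')"
    unfolding assoc_mult_mat[OF c(7,8,6)] by (rule mult_add_distrib_mat[OF c(7,5) NK2', symmetric])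
  then have LK: "L2 * K2 + L2 * N * K2' = 1\<^sub>m a"
    by (simp add: L2)
  have AK2: "A * K2 = \<Omega> * (B * K2) + B' * K2"
    unfolding A add_mult_distrib_mat[OF mult_carrier_mat[OF c(10,2)] c(3,5)] assoc_mult_mat[OF c(10,2,5)] ..
  have "\<Omega> * - (B * K2) = - (\<Omega> * (B * K2))"
    by (rule uminus_mult_right_mat) (use c in simp)
  \<comment> \<open>The two terms \<open>B * K2'\<close> cancel, and the rest cancels because
    \<open>A = \<Omega> * B + B'\<close>.\<close>
  then have up: "\<Omega> * - (B * K2) + A * K2 + (- (B' * K2 + B * K2') + B * K2') = 0\<^sub>m d a"
    unfolding AK2 using c' by (intro eq_matI) simp_all
  have "1\<^sub>m d * \<Omega> + A * 0\<^sub>m a d = \<Omega>" "1\<^sub>m d * 0\<^sub>m d a + A * 1\<^sub>m a = A"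
    "0\<^sub>m a d * \<Omega> + L2 * 0\<^sub>m a d = 0\<^sub>m a d" "0\<^sub>m a d * 0\<^sub>m d a + L2 * 1\<^sub>m a = L2"
    using c by simp_all
  then have LF: "L * four_block_mat \<Omega> (0\<^sub>m d a) (0\<^sub>m a d) (1\<^sub>m a) = four_block_mat \<Omega> A (0\<^sub>m a d) L2"
    unfolding L_def
    by (subst mult_four_block_mat[of _ d d _ a _ a _ _ d _ a]) (use c in simp_all)
  have "\<Omega> * 1\<^sub>m d + A * 0\<^sub>m a d = \<Omega>" "0\<^sub>m a d * 1\<^sub>m d + L2 * 0\<^sub>m a d = 0\<^sub>m a d"
    "0\<^sub>m a d * - (B * K2) + L2 * K2 = L2 * K2"
    using c' mult_carrier_mat[OF c(7,5)] by (simp_all add: uminus_0 left_mult_zero_mat[of _ d a])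
  note e = this
  have LFK: "four_block_mat \<Omega> A (0\<^sub>m a d) L2 * K =
      four_block_mat \<Omega> (\<Omega> * - (B * K2) + A * K2) (0\<^sub>m a d) (L2 * K2)"
    unfolding K_def mult_four_block_mat[OF c(10,1) zero_carrier_mat c(7)
        one_carrier_mat uminus_carrier_mat[OF BK2] zero_carrier_mat c(5)] e ..
  let ?U = "- (B' * K2 + B * K2')"
  have U: "?U \<in> carrier_mat d a"
    using BK2' by simp
  have "1\<^sub>m d * 0\<^sub>m d d + B * 0\<^sub>m a d = 0\<^sub>m d d" "1\<^sub>m d * ?U + B * K2' = ?U + B * K2'"
    "0\<^sub>m a d * 0\<^sub>m d d + L2 * N * 0\<^sub>m a d = 0\<^sub>m a d" "0\<^sub>m a d * ?U + L2 * N * K2' = L2 * N * K2'"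
    using c' mult_carrier_mat[OF LN c(6)]
    by (simp_all add: uminus_0 left_mult_one_mat[OF U] left_mult_zero_mat[OF U])
  note e = this
  have LEK': "four_block_mat (1\<^sub>m d) B (0\<^sub>m a d) (L2 * N) * K' =
      four_block_mat (0\<^sub>m d d) (?U + B * K2') (0\<^sub>m a d) (L2 * N * K2')"
    unfolding K'_def mult_four_block_mat[OF one_carrier_mat c(2) zero_carrier_mat LN
        zero_carrier_mat U zero_carrier_mat c(6)] e ..
  show "L * four_block_mat \<Omega> (0\<^sub>m d a) (0\<^sub>m a d) (1\<^sub>m a) * K +
      L * four_block_mat (1\<^sub>m d) E (0\<^sub>m a d) N * K' =
      four_block_mat \<Omega> (0\<^sub>m d a) (0\<^sub>m a d) (1\<^sub>m a)"
    unfolding LE LF LFK LEK'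
    by (subst add_four_block_mat[of _ d d _ a _ a]) (use c' U up LK in simp_all)
qed

section \<open>From blocks to entries and matrix functions\<close>

lemma block_of_index:
  assumes "r < total_size n l"
  obtains i p where "i < n" "p < l (Suc i)" "r = total_size i l + p"
proof -
  have "\<exists>i<n. \<exists>p<l (Suc i). r = total_size i l + p"
    using assms
  proof (induction n)
    case (Suc n)
    show ?case
    proof (cases "r < total_size n l")
      case True
      with Suc.IH show ?thesis
        by (meson less_SucI)
    next
      case False
      then show ?thesis
        using Suc.prems by (intro exI[of _ n] conjI exI[of _ "r - total_size n l"])
          (simp_all add: total_size_Suc)
    qed
  qed simp
  then show thesis
    using that by blast
qed

text \<open>The row lies in block \<open>i\<close> or later and the column in block \<open>i\<close>
  or earlier, so the entry belongs to a block on or below the diagonal.\<close>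

lemma SUT_entry_eq_0:
  assumes "N \<in> SUT I \<mu> l" "t \<in> I" "i < \<mu>" "total_size i l \<le> r" "r < total_size \<mu> l"
    "c < total_size (Suc i) l"
  shows "N t $$ (r, c) = 0"
proof -
  obtain i' p where r: "i' < \<mu>" "p < l (Suc i')" "r = total_size i' l + p"
    using assms(5) by (rule block_of_index)
  obtain j q where c: "j < Suc i" "q < l (Suc j)" "c = total_size j l + q"
    using assms(6) by (rule block_of_index)
  have "i \<le> i'"
  proof (rule ccontr)
    assume "\<not> i \<le> i'"
    then have "total_size (Suc i') l \<le> total_size i l"
      by (intro total_size_mono) simp
    then show False
      using r assms(4) by (simp add: total_size_Suc)
  qed
  then have "block l (N t) (Suc i') (Suc j) = 0\<^sub>m (l (Suc i')) (l (Suc j))"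
    using assms(1-3) r(1) c(1) by (auto simp: SUT_def)
  then have "block l (N t) (Suc i') (Suc j) $$ (p, q) = 0"
    using r(2) c(2) by simp
  then show ?thesis
    using r c by (simp add: block_def block_start_eq_total_size)
qed

text \<open>Supplies the witness for \<open>F22\<close>. Different blocks have no index in common,
  so the ones of the identity stay in diagonal blocks.\<close>

lemma one_in_BUT_nonsingular: "(\<lambda>_. 1\<^sub>m (total_size \<mu> l)) \<in> BUT_nonsingular I \<mu> l"
proof -
  have "block l (1\<^sub>m (total_size \<mu> l)) i j = 0\<^sub>m (l i) (l j)"
    if "i \<in> {1..\<mu>}" "j \<in> {1..\<mu>}" "j < i" for i j
  proof (rule eq_matI)
    fix p q assume pq: "p < dim_row (0\<^sub>m (l i) (l j) :: real mat)" "q < dim_col (0\<^sub>m (l i) (l j) :: real mat)"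
    then have "block_start l i + p \<noteq> block_start l j + q"
      using block_index_unique[of i j p l q] that by auto
    then show "block l (1\<^sub>m (total_size \<mu> l)) i j $$ (p, q) = 0\<^sub>m (l i) (l j) $$ (p, q)"
      using pq that block_index_less[of i \<mu> p l] block_index_less[of j \<mu> q l] by (simp add: block_def)
  qed (simp_all add: block_def)
  moreover have "invertible_mat (1\<^sub>m (total_size \<mu> l) :: real mat)"
    by (rule invertible_mat_if_det[of _ "total_size \<mu> l"]) simp_all
  ultimately show ?thesis
    by (auto simp: BUT_nonsingular_def BUT_def matfun_on_def)
qed

lemma mult_mat_entry:
  assumes "A \<in> carrier_mat nr n" "B \<in> carrier_mat n nc" "i < nr" "j < nc"
  shows "(A * B) $$ (i, j) = (\<Sum>p<n. A $$ (i, p) * B $$ (p, j))"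
  using assms by (simp add: scalar_prod_def lessThan_atLeast0)

lemma smooth_four_block_fun:
  assumes "A \<in> smooth_matfun k I n1 m1" "B \<in> smooth_matfun k I n1 m2"
    "C \<in> smooth_matfun k I n2 m1" "F \<in> smooth_matfun k I n2 m2"
  shows "four_block_fun A B C F \<in> smooth_matfun k I (n1 + n2) (m1 + m2)"
  unfolding smooth_matfun_iff
proof (intro conjI ballI allI impI)
  have c: "A t \<in> carrier_mat n1 m1" "B t \<in> carrier_mat n1 m2" "C t \<in> carrier_mat n2 m1"
    "F t \<in> carrier_mat n2 m2" if "t \<in> I" for t
    using assms that by (simp_all add: smooth_matfun_iff)
  show "four_block_fun A B C F t \<in> carrier_mat (n1 + n2) (m1 + m2)" if "t \<in> I" for t
    using c[OF that] by (simp add: four_block_fun_def)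
  fix i j assume ij: "i < n1 + n2" "j < m1 + m2"
  have "four_block_fun A B C F t $$ (i, j) =
      (if i < n1 then if j < m1 then A t $$ (i, j) else B t $$ (i, j - m1)
       else if j < m1 then C t $$ (i - n1, j) else F t $$ (i - n1, j - m1))" if "t \<in> I" for t
    using c[OF that] ij by (simp add: four_block_fun_def)
  moreover have "smooth_on k I (\<lambda>t. if i < n1 then if j < m1 then A t $$ (i, j) else B t $$ (i, j - m1)
       else if j < m1 then C t $$ (i - n1, j) else F t $$ (i - n1, j - m1))"
    using assms ij by (cases "i < n1"; cases "j < m1") (simp_all add: smooth_matfun_iff)
  ultimately show "smooth_on k I (\<lambda>t. four_block_fun A B C F t $$ (i, j))"
    by (subst smooth_on_cong)
qed

section \<open>Assembly of the equivalence\<close>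

context nontrivial_interval
begin

lemma mat_deriv_eqI:
  assumes "M t \<in> carrier_mat nr nc" "M' \<in> carrier_mat nr nc"
    and "\<And>i j. i < nr \<Longrightarrow> j < nc \<Longrightarrow> D (\<lambda>s. M s $$ (i, j)) t = M' $$ (i, j)"
  shows "mat_deriv I M t = M'"
  by (rule eq_matI) (use assms in \<open>auto simp: mat_deriv_def D_def\<close>)

text \<open>Settles the second equivalence of the theorem: with \<open>F12 = 0\<close> and
  \<open>F22 = I\<close> the two pairs coincide.\<close>

lemma pair_equiv_refl:
  assumes E: "E \<in> matfun_on I m m" and F: "F \<in> matfun_on I m m"
  shows "pair_equiv k I m (E, F) (E, F)"
proof -
  have one: "(\<lambda>_. 1\<^sub>m m) \<in> smooth_matfun k I m m"
    by (simp add: smooth_matfun_iff)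
  have inv: "invertible_mat (1\<^sub>m m :: real mat)"
    by (rule invertible_mat_if_det[of _ m]) simp_all
  have deriv: "mat_deriv I (\<lambda>_. 1\<^sub>m m) t = 0\<^sub>m m m" if "t \<in> I" for t
    by (rule mat_deriv_eqI[of _ _ m m]) (use that in simp_all)
  have eq: "E t = 1\<^sub>m m * E t * 1\<^sub>m m" "F t = 1\<^sub>m m * F t * 1\<^sub>m m + 1\<^sub>m m * E t * mat_deriv I (\<lambda>_. 1\<^sub>m m) t"
    if "t \<in> I" for t
  proof -
    have "E t \<in> carrier_mat m m" "F t \<in> carrier_mat m m"
      using E F that by (simp_all add: matfun_on_def)
    then show "E t = 1\<^sub>m m * E t * 1\<^sub>m m"
      "F t = 1\<^sub>m m * F t * 1\<^sub>m m + 1\<^sub>m m * E t * mat_deriv I (\<lambda>_. 1\<^sub>m m) t"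
      unfolding deriv[OF that] by simp_all
  qed
  show ?thesis
    unfolding pair_equiv_def prod.case
    by (intro conjI bexI[of _ "\<lambda>_. 1\<^sub>m m"] ballI E F inv eq one)
qed

text \<open>Translates the canonical form into conditions on entries; full row rank of the
  superdiagonal blocks becomes independence of their rows.\<close>

lemma S_canonical_staircase:
  assumes S: "S_canonical I d \<mu> l \<Omega> E N" and mono: "mono_on {1..\<mu>} l"
  shows "staircase I l \<mu> (\<lambda>r c t. N t $$ (r, c))"
proof unfold_locales
  have SUT: "N \<in> SUT I \<mu> l"
    and rank: "\<And>t i. t \<in> I \<Longrightarrow> i \<in> {1..<\<mu>} \<Longrightarrow> vec_space.rank (l i) (block l (N t) i (i + 1)) = l i"
    using S by (simp_all add: S_canonical_def SUT_row_def)
  show "l (Suc i) \<le> l (Suc (Suc i))" if "Suc i < \<mu>" for i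
    using that by (intro mono_onD[OF mono]) simp_all
  show "N t $$ (r, c) = 0"
    if "t \<in> I" "i < \<mu>" "total_size i l \<le> r" "r < total_size \<mu> l" "c < total_size (Suc i) l" for t i r c
    by (rule SUT_entry_eq_0[OF SUT that])
  fix t i u p
  assume t: "t \<in> I" and i: "Suc i < \<mu>" and p: "p < l (Suc i)"
    and u: "\<And>j. j < l (Suc (Suc i)) \<Longrightarrow>
      (\<Sum>p<l (Suc i). u p * N t $$ (total_size i l + p, total_size (Suc i) l + j)) = 0"
  let ?M = "block l (N t) (Suc i) (Suc (Suc i))"
  show "u p = 0"
  proof (rule full_rank_rows_independent[of ?M "l (Suc i)" "l (Suc (Suc i))" u p])
    show "?M \<in> carrier_mat (l (Suc i)) (l (Suc (Suc i)))"
      by (simp add: block_def)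
    show "vec_space.rank (l (Suc i)) ?M = l (Suc i)"
      using rank[OF t, of "Suc i"] i by simp
    show "(\<Sum>p<l (Suc i). u p * ?M $$ (p, j)) = 0" if "j < l (Suc (Suc i))" for j
      using u[OF that] that by (simp add: block_def block_start_eq_total_size)
  qed (rule p)
qed

text \<open>Both \<open>K\<close> and \<open>B\<close> are needed in class \<open>k + 1\<close>,
  since their derivatives must be of class \<open>k\<close>. The chain construction then asks for
  order \<open>k + \<mu>\<close> and the decoupling for \<open>k + 1 + a\<close>; the order
  \<open>k + a + \<mu> + 1\<close> covers both.\<close>

lemma S_canonical_equiv_constant:
  assumes S: "S_canonical I d \<mu> l \<Omega> E N" and mono: "mono_on {1..\<mu>} l"
    and \<mu>: "1 \<le> \<mu>" and k: "1 \<le> k" and a: "a = total_size \<mu> l"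
    and s\<Omega>: "\<Omega> \<in> smooth_matfun (k + enat (a + \<mu> + 1)) I d d"
    and sE: "E \<in> smooth_matfun (k + enat (a + \<mu> + 1)) I d a"
    and sN: "N \<in> smooth_matfun (k + enat (a + \<mu> + 1)) I a a"
  shows "pair_equiv k I (d + a)
    (four_block_fun (\<lambda>_. 1\<^sub>m d) E (\<lambda>_. 0\<^sub>m a d) N,
     four_block_fun \<Omega> (\<lambda>_. 0\<^sub>m d a) (\<lambda>_. 0\<^sub>m a d) (\<lambda>_. 1\<^sub>m a))
    (four_block_fun (\<lambda>_. 1\<^sub>m d) (\<lambda>_. 0\<^sub>m d a) (\<lambda>_. 0\<^sub>m a d) (\<lambda>_. N_Er \<mu> l),
     four_block_fun \<Omega> (\<lambda>_. 0\<^sub>m d a) (\<lambda>_. 0\<^sub>m a d) (\<lambda>_. 1\<^sub>m a))"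
proof -
  define n where "n r c t = N t $$ (r, c)" for r c t
  define w where "w r c t = \<Omega> t $$ (r, c)" for r c t
  define e12 where "e12 r c t = E t $$ (r, c)" for r c t
  interpret staircase I l \<mu> n
    unfolding n_def by (rule S_canonical_staircase[OF S mono])
  obtain m where m: "\<mu> = Suc m"
    using \<mu> by (cases \<mu>) auto
  have carrier: "\<Omega> t \<in> carrier_mat d d" "E t \<in> carrier_mat d a" "N t \<in> carrier_mat a a"
    if "t \<in> I" for t
    using s\<Omega> sE sN that by (simp_all add: smooth_matfun_iff)
  have class_eq: "k + 1 + enat x = k + enat (x + 1)" for x
    by (simp add: one_enat_def add.assoc)
  have le: "k + enat x \<le> k + enat (a + \<mu> + 1)" if "x \<le> a + \<mu> + 1" for x
    using that by (intro add_left_mono) simp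
  have n_fun: "n r c = (\<lambda>t. N t $$ (r, c))" "w r c = (\<lambda>t. \<Omega> t $$ (r, c))"
    "e12 r c = (\<lambda>t. E t $$ (r, c))" for r c
    by (simp_all add: n_def w_def e12_def fun_eq_iff)
  have sn: "sm (k + enat x) (n r c)" if "r < a" "c < a" "x \<le> a + \<mu> + 1" for r c x
    unfolding n_fun by (rule smooth_on_mono[OF _ le[OF that(3)]]) (use sN that in \<open>simp add: smooth_matfun_iff\<close>)
  have sw: "sm (k + enat x) (w r c)" if "r < d" "c < d" "x \<le> a + \<mu> + 1" for r c x
    unfolding n_fun by (rule smooth_on_mono[OF _ le[OF that(3)]]) (use s\<Omega> that in \<open>simp add: smooth_matfun_iff\<close>)
  have se: "sm (k + enat x) (e12 r c)" if "r < d" "c < a" "x \<le> a + \<mu> + 1" for r c x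
    unfolding n_fun by (rule smooth_on_mono[OF _ le[OF that(3)]]) (use sE that in \<open>simp add: smooth_matfun_iff\<close>)
  have sn0: "sm k (n r c)" if "r < a" "c < a" for r c
    using sn[OF that, of 0] by (simp flip: zero_enat_def)
  have sw0: "sm k (w r c)" if "r < d" "c < d" for r c
    using sw[OF that, of 0] by (simp flip: zero_enat_def)
  \<comment> \<open>Strict block triangularity gives strict triangularity of the entries, which the
    columnwise decoupling relies on.\<close>
  have n_upper: "n p c t = 0" if t: "t \<in> I" and p: "p < a" and c: "c \<le> p" for p c t
  proof -
    obtain i q where i: "i < \<mu>" "q < l (Suc i)" "p = s i + q"
      using p unfolding a by (rule block_of_index)
    show ?thesis
      by (rule N_zero[OF t i(1)]) (use i p c a in \<open>simp_all add: total_size_Suc\<close>)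
  qed
  have "\<exists>K. (\<forall>r<a. \<forall>c<a. sm (k + 1) (K r c)) \<and>
    (\<forall>t\<in>I.
      (\<forall>r<a. \<forall>c<a. (\<Sum>p<a. n r p t * K p c t) =
        (\<Sum>p<a. n r p t * (\<Sum>q<a. D (K p q) t * e q c)) + (\<Sum>q<a. K r q t * e q c)) \<and>
      nonsing a (\<lambda>r c. K r c t) \<and>
      nonsing a (\<lambda>r c. K r c t + (\<Sum>p<a. n r p t * D (K p c) t)) \<and>
      nonsing (l (Suc m)) (\<lambda>i j. K (s m + i) (s m + j) t))"
    unfolding a m
  proof (rule exists_chain_transformation)
    show "sm (k + 1 + enat m) (n r c)" if "r < s \<mu>" "c < s \<mu>" for r c
      unfolding class_eq using that by (intro sn) (simp_all add: a m)
  qed (use m in simp_all)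
  then obtain K where sK: "\<forall>r<a. \<forall>c<a. sm (k + 1) (K r c)"
    and K: "\<forall>t\<in>I.
      (\<forall>r<a. \<forall>c<a. (\<Sum>p<a. n r p t * K p c t) =
        (\<Sum>p<a. n r p t * (\<Sum>q<a. D (K p q) t * e q c)) + (\<Sum>q<a. K r q t * e q c)) \<and>
      nonsing a (\<lambda>r c. K r c t) \<and>
      nonsing a (\<lambda>r c. K r c t + (\<Sum>p<a. n r p t * D (K p c) t)) \<and>
      nonsing (l (Suc m)) (\<lambda>i j. K (s m + i) (s m + j) t)"
    by (elim exE conjE)
  have "\<exists>B. (\<forall>r<d. \<forall>c<a. sm (k + 1) (B r c)) \<and>
    (\<forall>r<d. \<forall>c<a. \<forall>t. B r c t =
      e12 r c t + (\<Sum>p<c. ((\<Sum>q<d. w r q t * B q p t) + D (B r p) t) * n p c t))"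
    by (rule exists_decoupling) (unfold class_eq, (rule sw se sn; simp)+)
  then obtain B where sB: "\<forall>r<d. \<forall>c<a. sm (k + 1) (B r c)"
    and B: "\<forall>r<d. \<forall>c<a. \<forall>t. B r c t =
      e12 r c t + (\<Sum>p<c. ((\<Sum>q<d. w r q t * B q p t) + D (B r p) t) * n p c t)"
    by (elim exE conjE)
  have sB0: "sm k (B r c)" if "r < d" "c < a" for r c
    by (rule smooth_on_mono[of "k + 1"]) (use sB that in simp_all)
  have sK0: "sm k (K r c)" if "r < a" "c < a" for r c
    by (rule smooth_on_mono[of "k + 1"]) (use sK that in simp_all)
  have sDB: "sm k (D (B r c))" if "r < d" "c < a" for r c
    by (rule smooth_D) (use sB that in simp)
  have sDK: "sm k (D (K r c))" if "r < a" "c < a" for r c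
    by (rule smooth_D) (use sK that in simp)
  \<comment> \<open>\<open>K\<close> plus \<open>N\<close> times the derivative of \<open>K\<close>;
    its smooth inverse \<open>H\<close> is the lower right block of the left transformation.\<close>
  define G where "G r c t = K r c t + (\<Sum>p<a. n r p t * D (K p c) t)" for r c t
  have sG: "sm k (G r c)" if "r < a" "c < a" for r c
    unfolding G_def using that by (intro smooth_on_add smooth_on_sum smooth_on_mult sK0 sDK sn0) auto
  have nsG: "nonsing a (\<lambda>r c. G r c t)" if "t \<in> I" for t
    unfolding G_def using K that by blast
  obtain H where sH: "\<And>i j. i < a \<Longrightarrow> j < a \<Longrightarrow> sm k (H i j)"
    and HG: "\<And>t. t \<in> I \<Longrightarrow> mat a a (\<lambda>(i, j). H i j t) * mat a a (\<lambda>(i, j). G i j t) = 1\<^sub>m a"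
    by (rule smooth_left_inverse[of a k I G, OF sG nsG that])
  define Km where "Km t = mat a a (\<lambda>(i, j). K i j t)" for t
  define DK where "DK t = mat a a (\<lambda>(i, j). D (K i j) t)" for t
  define Hm where "Hm t = mat a a (\<lambda>(i, j). H i j t)" for t
  define Bm where "Bm t = mat d a (\<lambda>(i, j). B i j t)" for t
  define DB where "DB t = mat d a (\<lambda>(i, j). D (B i j) t)" for t
  define Am where "Am t = mat d a (\<lambda>(i, j). (\<Sum>q<d. w i q t * B q j t) + D (B i j) t)" for t
  define Um where "Um t = mat d a (\<lambda>(i, j). - (\<Sum>p<a. B i p t * K p j t))" for t
  have mc: "Km t \<in> carrier_mat a a" "DK t \<in> carrier_mat a a" "Hm t \<in> carrier_mat a a"
    "Bm t \<in> carrier_mat d a" "DB t \<in> carrier_mat d a" "Am t \<in> carrier_mat d a" "Um t \<in> carrier_mat d a"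
    for t
    by (simp_all add: Km_def DK_def Hm_def Bm_def DB_def Am_def Um_def)
  have entry: "i < a \<Longrightarrow> j < a \<Longrightarrow> Km t $$ (i, j) = K i j t"
    "i < a \<Longrightarrow> j < a \<Longrightarrow> DK t $$ (i, j) = D (K i j) t"
    "i < d \<Longrightarrow> j < a \<Longrightarrow> Bm t $$ (i, j) = B i j t"
    "i < d \<Longrightarrow> j < a \<Longrightarrow> DB t $$ (i, j) = D (B i j) t" for i j t
    by (simp_all add: Km_def DK_def Bm_def DB_def)
  have Ner: "N_Er \<mu> l \<in> carrier_mat a a"
    by (simp add: N_Er_def a)
  have A_eq: "Am t = \<Omega> t * Bm t + DB t" if t: "t \<in> I" for t
    by (rule eq_matI)
      (use carrier[OF t] mc[of t] in \<open>auto simp: mult_mat_entry[OF carrier(1)[OF t] mc(4)] Am_def entry w_def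
        simp del: index_mult_mat(1)\<close>)
  have B_eq: "Bm t = E t + Am t * N t" if t: "t \<in> I" for t
  proof (rule eq_matI)
    fix r c assume "r < dim_row (E t + Am t * N t)" "c < dim_col (E t + Am t * N t)"
    then have rc: "r < d" "c < a"
      using carrier[OF t] mc(6)[of t] by auto
    have "B r c t = e12 r c t + (\<Sum>p<c. ((\<Sum>q<d. w r q t * B q p t) + D (B r p) t) * n p c t)"
      by (rule B[rule_format, OF rc])
    \<comment> \<open>The additional terms vanish by \<open>n_upper\<close>, which turns the
      recursion into a matrix product.\<close>
    also have "(\<Sum>p<c. ((\<Sum>q<d. w r q t * B q p t) + D (B r p) t) * n p c t) =
        (\<Sum>p<a. ((\<Sum>q<d. w r q t * B q p t) + D (B r p) t) * n p c t)"
      by (rule sum.mono_neutral_left) (use rc n_upper[OF t] in auto)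
    also have "\<dots> = (Am t * N t) $$ (r, c)"
      unfolding mult_mat_entry[OF mc(6) carrier(3)[OF t] rc]
      by (rule sum.cong) (use rc in \<open>simp_all add: Am_def n_def\<close>)
    finally show "Bm t $$ (r, c) = (E t + Am t * N t) $$ (r, c)"
      using rc carrier[OF t] mc(6)[of t] by (simp add: Bm_def e12_def del: index_mult_mat(1))
  qed (use carrier[OF t] mc[of t] in auto)
  have G_eq: "Km t + N t * DK t = mat a a (\<lambda>(i, j). G i j t)" if t: "t \<in> I" for t
    by (rule eq_matI)
      (use carrier[OF t] mc[of t] in \<open>auto simp: mult_mat_entry[OF carrier(3)[OF t] mc(2)] entry G_def n_def
        simp del: index_mult_mat(1)\<close>)
  have L2_eq: "Hm t * (Km t + N t * DK t) = 1\<^sub>m a" if t: "t \<in> I" for t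
    unfolding G_eq[OF t] using HG[OF t] by (simp add: Hm_def)
  have NK_eq: "N t * Km t = N t * (DK t * N_Er \<mu> l) + Km t * N_Er \<mu> l" if t: "t \<in> I" for t
  proof (rule eq_matI)
    fix r c assume "r < dim_row (N t * (DK t * N_Er \<mu> l) + Km t * N_Er \<mu> l)"
      "c < dim_col (N t * (DK t * N_Er \<mu> l) + Km t * N_Er \<mu> l)"
    then have rc: "r < a" "c < a"
      using mc[of t] Ner by auto
    have S_entry: "(\<Sum>q<a. g q * N_Er \<mu> l $$ (q, c)) = (\<Sum>q<a. g q * e q c)" for g
      by (rule sum.cong) (use rc in \<open>simp_all add: N_Er_entry a\<close>)
    have DKS: "(DK t * N_Er \<mu> l) $$ (p, c) = (\<Sum>q<a. D (K p q) t * e q c)" if "p < a" for p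
      unfolding mult_mat_entry[OF mc(2) Ner that rc(2)] S_entry
      by (rule sum.cong) (use that in \<open>simp_all add: DK_def\<close>)
    have "(N t * (DK t * N_Er \<mu> l)) $$ (r, c) = (\<Sum>p<a. n r p t * (\<Sum>q<a. D (K p q) t * e q c))"
      unfolding mult_mat_entry[OF carrier(3)[OF t] mult_carrier_mat[OF mc(2) Ner] rc]
      by (rule sum.cong) (simp_all only: DKS n_def lessThan_iff)
    moreover have "(Km t * N_Er \<mu> l) $$ (r, c) = (\<Sum>q<a. K r q t * e q c)"
      unfolding mult_mat_entry[OF mc(1) Ner rc] S_entry
      by (rule sum.cong) (use rc in \<open>simp_all add: Km_def\<close>)
    moreover have "(N t * Km t) $$ (r, c) = (\<Sum>p<a. n r p t * K p c t)"
      unfolding mult_mat_entry[OF carrier(3)[OF t] mc(1) rc]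
      by (rule sum.cong) (use rc in \<open>simp_all add: Km_def n_def\<close>)
    moreover have "(N t * (DK t * N_Er \<mu> l) + Km t * N_Er \<mu> l) $$ (r, c) =
        (N t * (DK t * N_Er \<mu> l)) $$ (r, c) + (Km t * N_Er \<mu> l) $$ (r, c)"
      by (rule index_add_mat(1)) (use rc mc[of t] Ner in auto)
    ultimately show "(N t * Km t) $$ (r, c) = (N t * (DK t * N_Er \<mu> l) + Km t * N_Er \<mu> l) $$ (r, c)"
      using K[rule_format, OF t, THEN conjunct1, rule_format, OF rc] by simp
  qed (use carrier[OF t] mc[of t] Ner in auto)
  have U_eq: "Um t = - (Bm t * Km t)" for t
    by (rule eq_matI)
      (use mc[of t] in \<open>auto simp: mult_mat_entry[OF mc(4) mc(1)] Um_def entry simp del: index_mult_mat(1)\<close>)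
  \<comment> \<open>\<open>L\<close> and \<open>T\<close> are the two transformations;
    \<open>T\<close> takes the role of \<open>K\<close> in the definition of equivalence.\<close>
  define L where "L = four_block_fun (\<lambda>_. 1\<^sub>m d) Am (\<lambda>_. 0\<^sub>m a d) Hm"
  define T where "T = four_block_fun (\<lambda>_. 1\<^sub>m d) Um (\<lambda>_. 0\<^sub>m a d) Km"
  have sL: "L \<in> smooth_matfun k I (d + a) (d + a)"
    unfolding L_def
  proof (rule smooth_four_block_fun)
    show "Am \<in> smooth_matfun k I d a"
      by (simp add: smooth_matfun_iff mc)
        (auto simp: Am_def intro!: smooth_on_add smooth_on_sum smooth_on_mult sw0 sB0 sDB)
    show "Hm \<in> smooth_matfun k I a a"
      by (simp add: smooth_matfun_iff mc) (simp add: Hm_def sH)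
  qed (simp_all add: smooth_matfun_iff)
  have sT: "T \<in> smooth_matfun k I (d + a) (d + a)"
    unfolding T_def
  proof (rule smooth_four_block_fun)
    show "Um \<in> smooth_matfun k I d a"
      by (simp add: smooth_matfun_iff mc)
        (auto simp: Um_def intro!: smooth_on_minus smooth_on_sum smooth_on_mult sK0 sB0)
    show "Km \<in> smooth_matfun k I a a"
      by (simp add: smooth_matfun_iff mc) (simp add: Km_def sK0)
  qed (simp_all add: smooth_matfun_iff)
  \<comment> \<open>The product rule for \<open>- (B K)\<close>, brought into the matrix form that
    \<open>block_equivalence\<close> expects.\<close>
  have DU: "D (\<lambda>t. - (\<Sum>p<a. B i p t * K p j t)) t = (- (DB t * Km t + Bm t * DK t)) $$ (i, j)"
    if t: "t \<in> I" and ij: "i < d" "j < a" for t i j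
  proof -
    have sBK: "sm k (\<lambda>t. B i p t * K p j t)" if "p < a" for p
      using that ij by (intro smooth_on_mult sB0 sK0)
    have "D (\<lambda>t. - (\<Sum>p<a. B i p t * K p j t)) t = - D (\<lambda>t. \<Sum>p<a. B i p t * K p j t) t"
      by (rule D_minus[OF smooth_on_sum k t]) (simp add: sBK)
    also have "D (\<lambda>t. \<Sum>p<a. B i p t * K p j t) t = (\<Sum>p<a. D (\<lambda>t. B i p t * K p j t) t)"
      by (rule D_sum[OF _ k t]) (simp add: sBK)
    also have "\<dots> = (\<Sum>p<a. D (B i p) t * K p j t + B i p t * D (K p j) t)"
      by (rule sum.cong) (use ij in \<open>simp_all add: D_mult[OF sB0 sK0 k t]\<close>)
    also have "\<dots> = (DB t * Km t) $$ (i, j) + (Bm t * DK t) $$ (i, j)"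
      unfolding mult_mat_entry[OF mc(5) mc(1) ij] mult_mat_entry[OF mc(4) mc(2) ij] sum.distrib[symmetric]
      by (rule sum.cong) (use ij in \<open>simp_all add: DB_def Km_def Bm_def DK_def\<close>)
    also have "- \<dots> = (- (DB t * Km t + Bm t * DK t)) $$ (i, j)"
      using ij mc[of t] by (simp del: index_mult_mat(1))
    finally show ?thesis .
  qed
  have DT: "mat_deriv I T t =
      four_block_mat (0\<^sub>m d d) (- (DB t * Km t + Bm t * DK t)) (0\<^sub>m a d) (DK t)" if t: "t \<in> I" for t
  proof (rule mat_deriv_eqI[of T t "d + a" "d + a"])
    show "T t \<in> carrier_mat (d + a) (d + a)"
      using sT t by (simp add: smooth_matfun_iff)
    have c: "- (DB t * Km t + Bm t * DK t) \<in> carrier_mat d a"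
      using mc[of t] by auto
    then show "four_block_mat (0\<^sub>m d d) (- (DB t * Km t + Bm t * DK t)) (0\<^sub>m a d) (DK t) \<in>
        carrier_mat (d + a) (d + a)"
      using mc(2)[of t] by (intro four_block_carrier_mat) simp_all
    fix i j assume ij: "i < d + a" "j < d + a"
    have "(\<lambda>s. T s $$ (i, j)) = (if i < d then if j < d then (\<lambda>_. 1\<^sub>m d $$ (i, j))
        else (\<lambda>s. - (\<Sum>p<a. B i p s * K p (j - d) s))
        else if j < d then (\<lambda>_. 0) else K (i - d) (j - d))"
      using ij by (auto simp: T_def four_block_fun_def fun_eq_iff Um_def Km_def)
    then show "D (\<lambda>s. T s $$ (i, j)) t = four_block_mat (0\<^sub>m d d) (- (DB t * Km t + Bm t * DK t)) (0\<^sub>m a d) (DK t) $$ (i, j)"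
      using ij c mc(2)[of t] t
      by (subst index_mat_four_block) (auto simp: DU DK_def simp del: index_uminus_mat)
  qed
  have inv: "invertible_mat (L t)" "invertible_mat (T t)" if t: "t \<in> I" for t
  proof -
    \<comment> \<open>Both transformations are block upper triangular with an identity in the upper
      left, so their determinants are those of \<open>Hm t\<close> and \<open>Km t\<close>.\<close>
    have "det (Hm t) * det (mat a a (\<lambda>(i, j). G i j t)) = 1"
      using det_mult[OF mc(3), of "mat a a (\<lambda>(i, j). G i j t)" t] HG[OF t] by (simp add: Hm_def)
    then have "det (Hm t) \<noteq> 0"
      by auto
    then have "det (L t) \<noteq> 0"
      unfolding L_def four_block_fun_def
      using det_four_block_mat_lower_left_zero[OF one_carrier_mat[of d] mc(6)[of t] refl mc(3)[of t]] by simp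
    then show "invertible_mat (L t)"
      using sL t by (intro invertible_mat_if_det[of _ "d + a"]) (simp_all add: smooth_matfun_iff)
    have "det (Km t) \<noteq> 0"
      using K t by (simp add: nonsing_iff_det Km_def)
    then have "det (T t) \<noteq> 0"
      unfolding T_def four_block_fun_def
      using det_four_block_mat_lower_left_zero[OF one_carrier_mat[of d] mc(7)[of t] refl mc(1)[of t]] by simp
    then show "invertible_mat (T t)"
      using sT t by (intro invertible_mat_if_det[of _ "d + a"]) (simp_all add: smooth_matfun_iff)
  qed
  have eqs: "four_block_mat (1\<^sub>m d) (0\<^sub>m d a) (0\<^sub>m a d) (N_Er \<mu> l) =
      L t * four_block_mat (1\<^sub>m d) (E t) (0\<^sub>m a d) (N t) * T t"
    "four_block_mat (\<Omega> t) (0\<^sub>m d a) (0\<^sub>m a d) (1\<^sub>m a) =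
      L t * four_block_mat (\<Omega> t) (0\<^sub>m d a) (0\<^sub>m a d) (1\<^sub>m a) * T t +
      L t * four_block_mat (1\<^sub>m d) (E t) (0\<^sub>m a d) (N t) * mat_deriv I T t" if t: "t \<in> I" for t
    unfolding DT[OF t] unfolding L_def T_def four_block_fun_def U_eq
    by (rule block_equivalence[OF mc(6,4,5) carrier(2)[OF t] mc(1,2,3) carrier(3)[OF t] Ner carrier(1)[OF t]
          A_eq[OF t] B_eq[OF t] L2_eq[OF t] NK_eq[OF t], symmetric])+
  have four_block_on: "four_block_fun P Q R S \<in> matfun_on I (d + a) (d + a)"
    if "P \<in> matfun_on I d d" "S \<in> matfun_on I a a" for P Q R S
    using that by (simp add: matfun_on_def four_block_fun_def)
  show ?thesis
    unfolding pair_equiv_def prod.case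
  proof (intro conjI; (rule bexI[OF _ sL], rule bexI[OF _ sT], intro ballI conjI)?)
    fix t assume t: "t \<in> I"
    show "invertible_mat (L t)" "invertible_mat (T t)"
      using inv[OF t] .
    show "four_block_fun (\<lambda>_. 1\<^sub>m d) (\<lambda>_. 0\<^sub>m d a) (\<lambda>_. 0\<^sub>m a d) (\<lambda>_. N_Er \<mu> l) t =
        L t * four_block_fun (\<lambda>_. 1\<^sub>m d) E (\<lambda>_. 0\<^sub>m a d) N t * T t"
      using eqs(1)[OF t] by (simp only: four_block_fun_def)
    show "four_block_fun \<Omega> (\<lambda>_. 0\<^sub>m d a) (\<lambda>_. 0\<^sub>m a d) (\<lambda>_. 1\<^sub>m a) t =
        L t * four_block_fun \<Omega> (\<lambda>_. 0\<^sub>m d a) (\<lambda>_. 0\<^sub>m a d) (\<lambda>_. 1\<^sub>m a) t * T t +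
        L t * four_block_fun (\<lambda>_. 1\<^sub>m d) E (\<lambda>_. 0\<^sub>m a d) N t * mat_deriv I T t"
      using eqs(2)[OF t] by (simp only: four_block_fun_def)
  qed (rule four_block_on; use carrier Ner in \<open>simp add: matfun_on_def\<close>)+
qed

end

theorem mainTheorem3:
  fixes I :: "real set" and d a \<mu> :: nat and l :: "nat \<Rightarrow> nat" and k :: enat
  assumes "is_interval I" and "interior I \<noteq> {}"
    and "\<mu> \<ge> 2" and "\<And>i. i \<in> {1..\<mu>} \<Longrightarrow> l i > 0" and "mono_on {1..\<mu>} l"
    and "a = total_size \<mu> l"
    and "k \<ge> 1"
  shows "\<exists>s::enat. (k \<noteq> \<infinity> \<longrightarrow> s \<noteq> \<infinity>) \<and>
    (\<forall>\<Omega> E12 N.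
       \<Omega> \<in> smooth_matfun s I d d \<longrightarrow> E12 \<in> smooth_matfun s I d a \<longrightarrow>
       N \<in> smooth_matfun s I a a \<longrightarrow> S_canonical I d \<mu> l \<Omega> E12 N \<longrightarrow>
       (\<exists>F22 \<in> BUT_nonsingular I \<mu> l. \<exists>F12 \<in> matfun_on I d a.
          let
            P = (four_block_fun (\<lambda>_. 1\<^sub>m d) E12 (\<lambda>_. 0\<^sub>m a d) N,
                 four_block_fun \<Omega> (\<lambda>_. 0\<^sub>m d a) (\<lambda>_. 0\<^sub>m a d) (\<lambda>_. 1\<^sub>m a));
            Q = (four_block_fun (\<lambda>_. 1\<^sub>m d) (\<lambda>_. 0\<^sub>m d a) (\<lambda>_. 0\<^sub>m a d) (\<lambda>_. N_Er \<mu> l),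
                 four_block_fun \<Omega> F12 (\<lambda>_. 0\<^sub>m a d) F22);
            R = (four_block_fun (\<lambda>_. 1\<^sub>m d) (\<lambda>_. 0\<^sub>m d a) (\<lambda>_. 0\<^sub>m a d) (\<lambda>_. N_Er \<mu> l),
                 four_block_fun \<Omega> (\<lambda>_. 0\<^sub>m d a) (\<lambda>_. 0\<^sub>m a d) (\<lambda>_. 1\<^sub>m a))
          in pair_equiv k I (d + a) P Q \<and> Q \<in> PreSCF I d \<mu> l \<and> pair_equiv k I (d + a) Q R))"
proof -
  interpret nontrivial_interval I
    by unfold_locales (rule assms)+
  \<comment> \<open>The required order depends only on \<open>k\<close>, \<open>a\<close> and
    \<open>\<mu>\<close>, not on the given pair, and is finite for finite \<open>k\<close>.\<close>
  define s where "s = k + enat (a + \<mu> + 1)"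
  have s: "k \<noteq> \<infinity> \<longrightarrow> s \<noteq> \<infinity>"
    by (cases k) (simp_all add: s_def)
  have Ner: "N_Er \<mu> l \<in> carrier_mat a a"
    by (simp add: N_Er_def assms(6))
  have one: "(\<lambda>_. 1\<^sub>m a) \<in> BUT_nonsingular I \<mu> l"
    unfolding assms(6) by (rule one_in_BUT_nonsingular)
  have zero: "(\<lambda>_. 0\<^sub>m d a) \<in> matfun_on I d a"
    by (simp add: matfun_on_def)
  show ?thesis
  \<comment> \<open>The witnesses \<open>F22 = I\<close> and \<open>F12 = 0\<close> make the
    intermediate pair equal to the final one; one equivalence carries the content and the other is
    reflexivity.\<close>
  proof (intro exI[of _ s] conjI s allI impI bexI[OF _ one] bexI[OF _ zero], unfold Let_def, intro conjI)
    fix \<Omega> E12 N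
    assume smooth: "\<Omega> \<in> smooth_matfun s I d d" "E12 \<in> smooth_matfun s I d a" "N \<in> smooth_matfun s I a a"
      and S: "S_canonical I d \<mu> l \<Omega> E12 N"
    let ?P = "(four_block_fun (\<lambda>_. 1\<^sub>m d) E12 (\<lambda>_. 0\<^sub>m a d) N,
      four_block_fun \<Omega> (\<lambda>_. 0\<^sub>m d a) (\<lambda>_. 0\<^sub>m a d) (\<lambda>_. 1\<^sub>m a))"
    let ?E = "four_block_fun (\<lambda>_. 1\<^sub>m d) (\<lambda>_. 0\<^sub>m d a) (\<lambda>_. 0\<^sub>m a d) (\<lambda>_. N_Er \<mu> l)"
    let ?F = "four_block_fun \<Omega> (\<lambda>_. 0\<^sub>m d a) (\<lambda>_. 0\<^sub>m a d) (\<lambda>_. 1\<^sub>m a)"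
    have \<Omega>: "\<Omega> \<in> matfun_on I d d"
      using S by (simp add: S_canonical_def)
    have E: "?E \<in> matfun_on I (d + a) (d + a)" and F: "?F \<in> matfun_on I (d + a) (d + a)"
      using \<Omega> Ner by (simp_all add: matfun_on_def four_block_fun_def)
    show "pair_equiv k I (d + a) ?P (?E, ?F)"
      by (rule S_canonical_equiv_constant[OF S assms(5) _ assms(7,6) smooth[unfolded s_def]])
        (use assms(3) in simp)
    show "pair_equiv k I (d + a) (?E, ?F) (?E, ?F)"
      by (rule pair_equiv_refl[OF E F])
    have BUT: "(\<lambda>_. 0\<^sub>m a d * 0\<^sub>m d a) \<in> BUT I \<mu> l"
    proof -
      have "block l (0\<^sub>m a a) i j = 0\<^sub>m (l i) (l j)" if "i \<in> {1..\<mu>}" "j \<in> {1..\<mu>}" for i j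
        by (rule eq_matI)
          (use that block_index_less[of i \<mu> _ l] block_index_less[of j \<mu> _ l] in
            \<open>auto simp: block_def assms(6)\<close>)
      then show ?thesis
        by (simp add: BUT_def matfun_on_def assms(6))
    qed
    show "(?E, ?F) \<in> PreSCF I d \<mu> l"
      unfolding PreSCF_def Let_def mem_Collect_eq prod.case assms(6)[symmetric]
      by (intro exI[of _ \<Omega>] exI[of _ "\<lambda>_. 0\<^sub>m d a"] exI[of _ "\<lambda>_. 0\<^sub>m a d"] exI[of _ "\<lambda>_. 1\<^sub>m a"]
          conjI \<Omega> one zero BUT ballI) (simp_all add: matfun_on_def four_block_fun_def)
  qed
qed

end
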